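(* Let $n\ge2$ and let $(S_1,\dots,S_{n-1},P)$ be a $\Gamma_n$-contraction on a Hilbert space $\mathcal H$ with $\mathcal F_O$-tuple $(A_1,\dots,A_{n-1})$. Let $(R_1,\dots,R_{n-1},V)$ on $\mathcal K\supseteq\mathcal H$ be a minimal $\Gamma_n$-isometric dilation of $(S_1,\dots,S_{n-1},P)$. Then there exists a $\Gamma_n$-isometry $(W_1,\dots,W_{n-1},W)$ on $\mathcal K\ominus\mathcal H$ such that $(A_1,\dots,A_{n-1})=P_{\mathcal D_P}(W_1,\dots,W_{n-1})|_{\mathcal D_P}$, where $\mathcal D_P$ is regarded as a subspace of $\mathcal K\ominus\mathcal H$ through an isometric embedding; that is, there is an isometry $\varphi:\mathcal D_P\to\mathcal K\ominus\mathcal H$ with $A_i=\varphi^*W_i\varphi$ for $i=1,\dots,n-1$.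
   Context: All operators are bounded and act on complex Hilbert spaces. $\Gamma_n=\{(\sum_i z_i,\sum_{i<j}z_iz_j,\dots,\prod_i z_i):|z_i|\le1,\ 1\le i\le n\}\subset\mathbb C^n$. A commuting tuple $(S_1,\dots,S_{n-1},P)$ is a $\Gamma_n$-contraction if $\Gamma_n$ is a spectral set for it: its Taylor joint spectrum lies in $\Gamma_n$ and $\|r(S_1,\dots,S_{n-1},P)\|\le\sup_{\Gamma_n}|r|$ for all rational functions $r$ with poles off $\Gamma_n$. A commuting tuple is a $\Gamma_n$-unitary if all entries are normal and the Taylor joint spectrum lies in $b\Gamma_n=\{(s_1,\dots,s_{n-1},p)\in\Gamma_n:|p|=1\}$; a $\Gamma_n$-isometry if it is the restriction of a $\Gamma_n$-unitary to a common invariant subspace. For a contraction $P$, $D_P=(I-P^*P)^{1/2}$, $\mathcal D_P=\overline{\mathrm{Ran}}\,D_P$. For every $\Gamma_n$-contraction $(S_1,\dots,S_{n-1},P)$, $P$ is a contraction and there are unique $A_1,\dots,A_{n-1}\in\mathcal B(\mathcal D_P)$ with $S_i-S_{n-i}^*P=D_PA_iD_P$ ($1\le i\le n-1$); $(A_1,\dots,A_{n-1})$ is its $\mathcal F_O$-tuple. A $\Gamma_n$-isometric dilation of a $\Gamma_n$-contraction $(S_1,\dots,S_{n-1},P)$ on $\mathcal H$ is a $\Gamma_n$-isometry $(R_1,\dots,R_{n-1},V)$ on a Hilbert space $\mathcal K\supseteq\mathcal H$ with $P_{\mathcal H}R_1^{m_1}\cdots R_{n-1}^{m_{n-1}}V^m|_{\mathcal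 H}=S_1^{m_1}\cdots S_{n-1}^{m_{n-1}}P^m$ for all nonnegative integers $m_1,\dots,m_{n-1},m$; it is minimal if $\mathcal K=\overline{\mathrm{span}}\{R_1^{m_1}\cdots R_{n-1}^{m_{n-1}}V^mh:h\in\mathcal H,\ m_1,\dots,m_{n-1},m\ge0\}$. *)

theory Defs
  imports "HOL-Analysis.Analysis" "HOL-Library.Poly_Mapping"
begin

text \<open>
  A complex Hilbert space is a type of the class below, or a closed complex subspace of such a type.
  A subspace is given by its carrier, and an operator between carriers by a function on the
  ambient types whose values off the carrier are irrelevant.  The inner product is linear in its
  first argument; its real part is the \<open>inner\<close> of the library, so that norm, topology and
  completeness are the library's.
\<close>

class complex_hilbert_space = real_inner + complete_space +
  fixes scaleC :: "complex \<Rightarrow> 'a \<Rightarrow> 'a"  (infixr "*\<^sub>C" 75)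
    and cinner :: "'a \<Rightarrow> 'a \<Rightarrow> complex"
  assumes scaleC_add_right: "c *\<^sub>C (x + y) = c *\<^sub>C x + c *\<^sub>C y"
    and scaleC_add_left: "(c + d) *\<^sub>C x = c *\<^sub>C x + d *\<^sub>C x"
    and scaleC_scaleC: "c *\<^sub>C d *\<^sub>C x = (c * d) *\<^sub>C x"
    and scaleR_scaleC: "r *\<^sub>R x = complex_of_real r *\<^sub>C x"
    and cinner_commute: "cinner x y = cnj (cinner y x)"
    and cinner_add_left: "cinner (x + y) z = cinner x z + cinner y z"
    and cinner_scaleC_left: "cinner (c *\<^sub>C x) y = c * cinner x y"
    and inner_eq_Re_cinner: "inner x y = Re (cinner x y)"

global_interpretation complex_space:
  vector_space "scaleC :: complex \<Rightarrow> 'a \<Rightarrow> 'a::complex_hilbert_space"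
  defines csubspace = complex_space.subspace
    and cspan = complex_space.span
proof unfold_locales
  show "1 *\<^sub>C x = x" for x :: 'a
    using scaleR_scaleC[of 1 x] by simp
qed (simp_all add: scaleC_add_right scaleC_add_left scaleC_scaleC)

definition closed_csubspace :: "'a::complex_hilbert_space set \<Rightarrow> bool" where
  "closed_csubspace M \<longleftrightarrow> csubspace M \<and> closed M"

definition orth_diff :: "'a::complex_hilbert_space set \<Rightarrow> 'a set \<Rightarrow> 'a set"  (infixl "\<ominus>\<^sub>H" 65) where
  "K \<ominus>\<^sub>H M = {x \<in> K. \<forall>y\<in>M. cinner x y = 0}"

definition orth_proj :: "'a::complex_hilbert_space set \<Rightarrow> 'a \<Rightarrow> 'a" where
  "orth_proj M x = (THE y. y \<in> M \<and> x - y \<in> UNIV \<ominus>\<^sub>H M)"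


section \<open>Operators\<close>

definition bounded_op ::
  "'a::complex_hilbert_space set \<Rightarrow> 'b::complex_hilbert_space set \<Rightarrow> ('a \<Rightarrow> 'b) \<Rightarrow> bool" where
  "bounded_op M N T \<longleftrightarrow> T \<in> M \<rightarrow> N \<and>
     (\<forall>x\<in>M. \<forall>y\<in>M. T (x + y) = T x + T y) \<and>
     (\<forall>c. \<forall>x\<in>M. T (c *\<^sub>C x) = c *\<^sub>C T x) \<and>
     (\<exists>B. \<forall>x\<in>M. norm (T x) \<le> B * norm x)"

definition isometry_op ::
  "'a::complex_hilbert_space set \<Rightarrow> 'b::complex_hilbert_space set \<Rightarrow> ('a \<Rightarrow> 'b) \<Rightarrow> bool" where
  "isometry_op M N T \<longleftrightarrow> bounded_op M N T \<and> (\<forall>x\<in>M. norm (T x) = norm x)"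

text \<open>\<open>hadjoint M T\<close> is the adjoint of an operator \<open>T\<close> with domain \<open>M\<close>.\<close>

definition hadjoint ::
  "'a::complex_hilbert_space set \<Rightarrow> ('a \<Rightarrow> 'b::complex_hilbert_space) \<Rightarrow> 'b \<Rightarrow> 'a" where
  "hadjoint M T y = (THE z. z \<in> M \<and> (\<forall>x\<in>M. cinner (T x) y = cinner x z))"

definition normal_op :: "'a::complex_hilbert_space set \<Rightarrow> ('a \<Rightarrow> 'a) \<Rightarrow> bool" where
  "normal_op M T \<longleftrightarrow> bounded_op M M T \<and> (\<forall>x\<in>M. hadjoint M T (T x) = T (hadjoint M T x))"

definition positive_op :: "'a::complex_hilbert_space set \<Rightarrow> ('a \<Rightarrow> 'a) \<Rightarrow> bool" where
  "positive_op M T \<longleftrightarrow> bounded_op M M T \<and> (\<forall>x\<in>M. cinner (T x) x \<in> \<real>\<^sub>\<ge>\<^sub>0)"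

text \<open>\<open>is_defect_op M P D\<close>: on \<open>M\<close>, \<open>D\<close> is the (unique) positive square root of \<open>I - P\<^sup>*P\<close>.\<close>

definition is_defect_op ::
  "'a::complex_hilbert_space set \<Rightarrow> ('a \<Rightarrow> 'a) \<Rightarrow> ('a \<Rightarrow> 'a) \<Rightarrow> bool" where
  "is_defect_op M P D \<longleftrightarrow> positive_op M D \<and> (\<forall>x\<in>M. D (D x) = x - hadjoint M P (P x))"


section \<open>Commuting tuples and the Taylor joint spectrum\<close>

text \<open>
  Tuples of length \<open>n\<close> are indexed by \<open>{1..n}\<close>; points of \<open>\<complex>\<^sup>n\<close> are the elements of
  \<open>{1..n} \<rightarrow>\<^sub>E UNIV\<close>.
\<close>

definition commuting_tuple ::
  "nat \<Rightarrow> 'a::complex_hilbert_space set \<Rightarrow> (nat \<Rightarrow> 'a \<Rightarrow> 'a) \<Rightarrow> bool" where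
  "commuting_tuple n M T \<longleftrightarrow> (\<forall>i\<in>{1..n}. bounded_op M M (T i)) \<and>
     (\<forall>i\<in>{1..n}. \<forall>j\<in>{1..n}. \<forall>x\<in>M. T i (T j x) = T j (T i x))"

text \<open>
  The space \<open>M \<otimes> \<Lambda>(\<complex>\<^sup>n)\<close> is represented by coordinates: \<open>\<xi> J\<close>, for
  \<open>J = {j\<^sub>1 < \<dots> < j\<^sub>k} \<subseteq> {1..n}\<close>, is the coefficient of \<open>e\<^sub>j\<^sub>1 \<and> \<dots> \<and> e\<^sub>j\<^sub>k\<close>.
  The Koszul map is \<open>x \<otimes> \<omega> \<mapsto> (\<Sum>j. T\<^sub>j x \<otimes> (e\<^sub>j \<and> \<omega>))\<close>; moving \<open>e\<^sub>j\<close> to its place in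
  the ordered product gives the sign.  The map raises the degree by one, so exactness of the
  Koszul complex in all degrees says that its kernel equals its range on the whole space.
\<close>

definition koszul_space :: "nat \<Rightarrow> 'a set \<Rightarrow> (nat set \<Rightarrow> 'a) set" where
  "koszul_space n M = Pow {1..n} \<rightarrow>\<^sub>E M"

definition koszul_map ::
  "nat \<Rightarrow> (nat \<Rightarrow> 'a \<Rightarrow> 'a) \<Rightarrow> (nat set \<Rightarrow> 'a) \<Rightarrow> nat set \<Rightarrow> 'a::complex_hilbert_space" where
  "koszul_map n T \<xi> =
     (\<lambda>J\<in>Pow {1..n}. \<Sum>j\<in>J. (-1) ^ card {i\<in>J. i < j} *\<^sub>R T j (\<xi> (J - {j})))"

definition taylor_spectrum ::
  "nat \<Rightarrow> 'a::complex_hilbert_space set \<Rightarrow> (nat \<Rightarrow> 'a \<Rightarrow> 'a) \<Rightarrow> (nat \<Rightarrow> complex) set" where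
  "taylor_spectrum n M T =
     {l \<in> {1..n} \<rightarrow>\<^sub>E UNIV. let d = koszul_map n (\<lambda>i x. T i x - l i *\<^sub>C x) in
        {\<xi> \<in> koszul_space n M. d \<xi> = (\<lambda>J\<in>Pow {1..n}. 0)} \<noteq> d ` koszul_space n M}"


section \<open>Rational functional calculus and spectral sets\<close>

text \<open>
  A polynomial is a finitely supported family of coefficients indexed by exponent vectors.
\<close>

type_synonym cpoly = "(nat \<Rightarrow>\<^sub>0 nat) \<Rightarrow>\<^sub>0 complex"

definition poly_in_vars :: "nat \<Rightarrow> cpoly \<Rightarrow> bool" where
  "poly_in_vars n p \<longleftrightarrow> (\<forall>m \<in> Poly_Mapping.keys p. Poly_Mapping.keys m \<subseteq> {1..n})"

definition poly_val :: "nat \<Rightarrow> cpoly \<Rightarrow> (nat \<Rightarrow> complex) \<Rightarrow> complex" where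
  "poly_val n p z = (\<Sum>m\<in>Poly_Mapping.keys p.
     Poly_Mapping.lookup p m * (\<Prod>i=1..n. z i ^ Poly_Mapping.lookup m i))"

definition op_monom :: "nat \<Rightarrow> (nat \<Rightarrow> 'a \<Rightarrow> 'a) \<Rightarrow> (nat \<Rightarrow> nat) \<Rightarrow> 'a \<Rightarrow> 'a" where
  "op_monom n T m = foldr (\<lambda>i F. (T i ^^ m i) \<circ> F) [1..<Suc n] id"

definition op_poly ::
  "nat \<Rightarrow> cpoly \<Rightarrow> (nat \<Rightarrow> 'a \<Rightarrow> 'a) \<Rightarrow> 'a \<Rightarrow> 'a::complex_hilbert_space" where
  "op_poly n p T x = (\<Sum>m\<in>Poly_Mapping.keys p.
     Poly_Mapping.lookup p m *\<^sub>C op_monom n T (Poly_Mapping.lookup m) x)"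

text \<open>
  For compact nonempty \<open>X\<close>.  A rational function with poles off \<open>X\<close> is a quotient \<open>p / q\<close> of
  polynomials with \<open>q\<close> zero-free on \<open>X\<close>, and its value at \<open>T\<close> is \<open>p(T) q(T)\<^sup>-\<^sup>1\<close>.  That \<open>q(T)\<close>
  is invertible follows from the spectral inclusion by the spectral mapping theorem; it is recorded
  so that \<open>inv_into\<close> visibly denotes the inverse.  The norm bound is written out on vectors.
\<close>

definition spectral_set ::
  "nat \<Rightarrow> 'a::complex_hilbert_space set \<Rightarrow> (nat \<Rightarrow> complex) set \<Rightarrow> (nat \<Rightarrow> 'a \<Rightarrow> 'a) \<Rightarrow> bool" where
  "spectral_set n M X T \<longleftrightarrow> taylor_spectrum n M T \<subseteq> X \<and>
     (\<forall>p q. poly_in_vars n p \<and> poly_in_vars n q \<and> (\<forall>z\<in>X. poly_val n q z \<noteq> 0) \<longrightarrow>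
        bij_betw (op_poly n q T) M M \<and>
        (\<forall>x\<in>M. norm (op_poly n p T (inv_into M (op_poly n q T) x))
                 \<le> (SUP z\<in>X. cmod (poly_val n p z / poly_val n q z)) * norm x))"


section \<open>The symmetrized polydisc and its operator classes\<close>

definition elem_sym :: "nat \<Rightarrow> nat \<Rightarrow> (nat \<Rightarrow> complex) \<Rightarrow> complex" where
  "elem_sym n k z = (\<Sum>J | J \<subseteq> {1..n} \<and> card J = k. \<Prod>j\<in>J. z j)"

definition Gamma_set :: "nat \<Rightarrow> (nat \<Rightarrow> complex) set" where
  "Gamma_set n = (\<lambda>z. \<lambda>k\<in>{1..n}. elem_sym n k z) ` ({1..n} \<rightarrow>\<^sub>E cball 0 1)"

definition bGamma_set :: "nat \<Rightarrow> (nat \<Rightarrow> complex) set" where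
  "bGamma_set n = {s \<in> Gamma_set n. cmod (s n) = 1}"

text \<open>
  The tuple \<open>(S\<^sub>1, \<dots>, S\<^sub>n\<^sub>-\<^sub>1, P)\<close> is \<open>S(n := P)\<close>; only \<open>S 1, \<dots>, S (n - 1)\<close> matter.
\<close>

definition Gamma_contraction ::
  "nat \<Rightarrow> 'a::complex_hilbert_space set \<Rightarrow> (nat \<Rightarrow> 'a \<Rightarrow> 'a) \<Rightarrow> ('a \<Rightarrow> 'a) \<Rightarrow> bool" where
  "Gamma_contraction n M S P \<longleftrightarrow>
     commuting_tuple n M (S(n := P)) \<and> spectral_set n M (Gamma_set n) (S(n := P))"

definition Gamma_unitary ::
  "nat \<Rightarrow> 'a::complex_hilbert_space set \<Rightarrow> (nat \<Rightarrow> 'a \<Rightarrow> 'a) \<Rightarrow> ('a \<Rightarrow> 'a) \<Rightarrow> bool" where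
  "Gamma_unitary n M S P \<longleftrightarrow>
     commuting_tuple n M (S(n := P)) \<and> (\<forall>i\<in>{1..n}. normal_op M ((S(n := P)) i)) \<and>
     taylor_spectrum n M (S(n := P)) \<subseteq> bGamma_set n"

text \<open>
  The Hilbert space \<open>L\<close> carrying the \<open>\<Gamma>\<^sub>n\<close>-unitary extension is sought in the type given
  by the first argument, and \<open>M\<close> is identified with a subspace of \<open>L\<close> through the isometry \<open>J\<close>.
  HOL cannot quantify over types inside a definition: a statement that is polymorphic in the
  type argument of a hypothesis \<open>Gamma_isometry\<close> covers extensions to arbitrary Hilbert spaces.
\<close>

definition Gamma_isometry ::
  "'b::complex_hilbert_space itself \<Rightarrow>
   nat \<Rightarrow> 'a::complex_hilbert_space set \<Rightarrow> (nat \<Rightarrow> 'a \<Rightarrow> 'a) \<Rightarrow> ('a \<Rightarrow> 'a) \<Rightarrow> bool" where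
  "Gamma_isometry t n M S P \<longleftrightarrow>
     commuting_tuple n M (S(n := P)) \<and>
     (\<exists>(L :: 'b set) U Q J. closed_csubspace L \<and> Gamma_unitary n L U Q \<and> isometry_op M L J \<and>
        (\<forall>i\<in>{1..n}. \<forall>x\<in>M. J ((S(n := P)) i x) = (U(n := Q)) i (J x)))"

text \<open>
  \<open>D\<close> is the defect operator of \<open>P\<close>, so that \<open>closure (D ` M)\<close> is the defect space.
\<close>

definition is_FO_tuple ::
  "nat \<Rightarrow> 'a::complex_hilbert_space set \<Rightarrow> (nat \<Rightarrow> 'a \<Rightarrow> 'a) \<Rightarrow> ('a \<Rightarrow> 'a) \<Rightarrow> ('a \<Rightarrow> 'a) \<Rightarrow>
   (nat \<Rightarrow> 'a \<Rightarrow> 'a) \<Rightarrow> bool" where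
  "is_FO_tuple n M S P D A \<longleftrightarrow> (\<forall>i\<in>{1..n-1}.
     bounded_op (closure (D ` M)) (closure (D ` M)) (A i) \<and>
     (\<forall>x\<in>M. S i x - hadjoint M (S (n - i)) (P x) = D (A i (D x))))"

definition Gamma_isometric_dilation ::
  "'b::complex_hilbert_space itself \<Rightarrow> nat \<Rightarrow>
   'a::complex_hilbert_space set \<Rightarrow> (nat \<Rightarrow> 'a \<Rightarrow> 'a) \<Rightarrow> ('a \<Rightarrow> 'a) \<Rightarrow>
   'a set \<Rightarrow> (nat \<Rightarrow> 'a \<Rightarrow> 'a) \<Rightarrow> ('a \<Rightarrow> 'a) \<Rightarrow> bool" where
  "Gamma_isometric_dilation t n H S P K R V \<longleftrightarrow>
     H \<subseteq> K \<and> Gamma_isometry t n K R V \<and>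
     (\<forall>m. \<forall>h\<in>H. orth_proj H (op_monom n (R(n := V)) m h) = op_monom n (S(n := P)) m h)"

definition minimal_dilation ::
  "nat \<Rightarrow> 'a::complex_hilbert_space set \<Rightarrow> 'a set \<Rightarrow> (nat \<Rightarrow> 'a \<Rightarrow> 'a) \<Rightarrow> ('a \<Rightarrow> 'a) \<Rightarrow> bool" where
  "minimal_dilation n H K R V \<longleftrightarrow>
     K = closure (cspan {op_monom n (R(n := V)) m h | m h. h \<in> H})"

end

theory Submission
  imports Defs
begin

text \<open>
  By minimality \<open>K \<ominus> H\<close> is invariant under the dilation \<open>(R\<^sub>1, \<dots>, R\<^sub>n\<^sub>-\<^sub>1, V)\<close>, and \<open>W\<close> is the
  restriction.  Since \<open>P\<close> is the compression of the isometry \<open>V\<close>, the map \<open>D h \<mapsto> (V - P) h\<close> extends to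
  an isometry of the defect space into \<open>K \<ominus> H\<close>, and \<open>A\<^sub>i = \<phi>\<^sup>* W\<^sub>i \<phi>\<close> comes out of
  \<open>R\<^sub>i = R\<^sub>n\<^sub>-\<^sub>i\<^sup>* V\<close>.

  That identity is inherited from the unitary extension \<open>(U, Q)\<close>, where it has to be read off from the
  Taylor spectrum.  Both \<open>I - Q\<^sup>*Q\<close> and \<open>U\<^sub>i - U\<^sub>n\<^sub>-\<^sub>i\<^sup>* Q\<close> turn out to be normal; if one of them
  were nonzero, it would have a nonzero approximate eigenvalue.  Approximate eigenspaces
  of a normal operator reduce every normal operator commuting with it, so approximate eigenvectors
  can be refined to joint ones of the whole tuple.  The joint approximate eigenvalue lies
  in the Taylor spectrum, hence in \<open>b\<Gamma>\<^sub>n\<close>, where \<open>\<bar>s\<^sub>n\<bar> = 1\<close> and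
  \<open>s\<^sub>i = cnj s\<^sub>n\<^sub>-\<^sub>i * s\<^sub>n\<close>: a contradiction.
\<close>

section \<open>Hilbert space preliminaries\<close>

text \<open>The spectral hypothesis on \<open>(U, Q)\<close> speaks about exactness of Koszul
  complexes, while an operator identity is wanted. Approximate eigenvectors connect the two, and
  normality matters twice: a nonzero operator that is not normal may have 0 as its only approximate
  eigenvalue, and for a normal operator the adjoint has the same approximate eigenvectors.

  The obstacle is commutation with adjoints, usually supplied by Fuglede's theorem. Both operators
  that should vanish contain adjoints, so they are not seen to commute with the whole tuple. This
  dictates the order: \<open>Q\<close> is shown to be unitary first, so that its adjoint is an
  inverse and commutes with whatever \<open>Q\<close> commutes with; only then does the normality of
  \<open>U\<^sub>i - U\<^sub>n\<^sub>-\<^sub>i\<^sup>* Q\<close> follow. It also dictates a change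
  of approximate eigenspace in the middle of each argument: the information that the suspicious
  operator is nonzero is first stored in eigenvalues of members of the tuple, then that operator is
  dropped, and only the members, which commute with everything in sight, are refined to the whole
  tuple.\<close>

lemma cinner_add_right: "cinner x (y + z) = cinner x y + cinner x z"
  by (metis cinner_add_left cinner_commute complex_cnj_add)

lemma cinner_scaleC_right: "cinner x (c *\<^sub>C y) = cnj c * cinner x y"
  by (metis cinner_commute cinner_scaleC_left complex_cnj_mult)

lemma scaleC_minus1: "(- 1) *\<^sub>C x = - (x :: 'a::complex_hilbert_space)"
  using scaleR_scaleC[of "-1" x] by simp

lemma cinner_minus_left: "cinner (- x) y = - cinner x y"
  using cinner_scaleC_left[of "-1" x y] by (simp add: scaleC_minus1)

lemma cinner_minus_right: "cinner x (- y) = - cinner x y"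
  using cinner_scaleC_right[of x "-1" y] by (simp add: scaleC_minus1)

lemma cinner_diff_left: "cinner (x - y) z = cinner x z - cinner y z"
  using cinner_add_left[of x "- y" z] by (simp add: cinner_minus_left)

lemma cinner_diff_right: "cinner x (y - z) = cinner x y - cinner x z"
  using cinner_add_right[of x y "- z"] by (simp add: cinner_minus_right)

lemma cinner_zero_left [simp]: "cinner 0 x = 0"
  using cinner_diff_left[of 0 0 x] by simp

lemma cinner_zero_right [simp]: "cinner x 0 = 0"
  using cinner_diff_right[of x 0 0] by simp

lemmas cinner_simps = cinner_add_left cinner_add_right cinner_diff_left cinner_diff_right
  cinner_scaleC_left cinner_scaleC_right cinner_minus_left cinner_minus_right

text \<open>Facts about the real \<open>inner\<close> (continuity, orthogonality, polarization)
  carry over to \<open>cinner\<close> by using them at \<open>y\<close> and at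
  \<open>\<i> *\<^sub>C y\<close>.\<close>

lemma cinner_eq_Complex: "cinner x y = Complex (inner x y) (inner x (\<i> *\<^sub>C y))"
  by (simp add: complex_eq_iff inner_eq_Re_cinner cinner_scaleC_right)

lemma cinner_self: "cinner x x = complex_of_real ((norm x)\<^sup>2)"
proof -
  have "Im (cinner x x) = 0"
    using cinner_commute[of x x] by (metis complex_cnj_cancel_iff Reals_cnj_iff complex_is_Real_iff)
  then show ?thesis
    by (simp add: complex_eq_iff power2_norm_eq_inner inner_eq_Re_cinner)
qed

lemma norm_scaleC: "norm (c *\<^sub>C x) = cmod c * norm x"
proof -
  have "complex_of_real ((norm (c *\<^sub>C x))\<^sup>2) = complex_of_real ((cmod c * norm x)\<^sup>2)"
    unfolding cinner_self[symmetric] cinner_scaleC_left cinner_scaleC_right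
    by (simp add: cinner_self power_mult_distrib mult.assoc[symmetric] mult.commute[of "cnj c" c] complex_norm_square[symmetric]
        del: of_real_power)
  then have "(norm (c *\<^sub>C x))\<^sup>2 = (cmod c * norm x)\<^sup>2"
    using of_real_eq_iff by blast
  then show ?thesis
    by (simp add: power2_eq_iff_nonneg)
qed

lemma scaleC_simps [simp]:
  "(- c) *\<^sub>C x = - (c *\<^sub>C x)" "c *\<^sub>C (- x) = - (c *\<^sub>C x)"
  for x :: "'a::complex_hilbert_space"
  by (simp_all add: complex_space.scale_minus_left complex_space.scale_minus_right)

lemmas scaleC_diff_right = complex_space.scale_right_diff_distrib
lemmas scaleC_diff_left = complex_space.scale_left_diff_distrib

text \<open>Multiplying \<open>x\<close> by a unimodular \<open>c\<close> makes the product real and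
  nonnegative, which leaves the real Cauchy-Schwarz inequality.\<close>

lemma cinner_norm_le: "cmod (cinner x y) \<le> norm x * norm y"
proof (cases "cinner x y = 0")
  case False
  define c where "c = cnj (cinner x y) / cmod (cinner x y)"
  have c: "cmod c = 1" using False by (simp add: c_def norm_divide)
  have "c * cinner x y = complex_of_real (cmod (cinner x y))"
    using False by (simp add: c_def complex_norm_square[symmetric] mult.commute power2_eq_square)
  then have "cmod (cinner x y) = Re (cinner (c *\<^sub>C x) y)"
    by (simp add: cinner_scaleC_left)
  also have "\<dots> = inner (c *\<^sub>C x) y" by (simp add: inner_eq_Re_cinner)
  also have "\<dots> \<le> norm (c *\<^sub>C x) * norm y" by (rule norm_cauchy_schwarz)
  finally show ?thesis by (simp add: norm_scaleC c)
qed simp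

lemma tendsto_scaleC [tendsto_intros]:
  assumes "(f \<longlongrightarrow> l) F"
  shows "((\<lambda>x. c *\<^sub>C f x) \<longlongrightarrow> c *\<^sub>C l) F"
proof -
  have "((\<lambda>x. cmod c * norm (f x - l)) \<longlongrightarrow> 0) F"
    using assms by (intro tendsto_mult_right_zero tendsto_norm_zero LIM_zero)
  then have "((\<lambda>x. c *\<^sub>C f x - c *\<^sub>C l) \<longlongrightarrow> 0) F"
    by (subst tendsto_norm_zero_iff[symmetric]) (simp add: scaleC_diff_right[symmetric] norm_scaleC)
  then show ?thesis by (simp add: LIM_zero_iff)
qed

lemma tendsto_cinner [tendsto_intros]:
  assumes "(f \<longlongrightarrow> a) F" "(g \<longlongrightarrow> b) F"
  shows "((\<lambda>x. cinner (f x) (g x)) \<longlongrightarrow> cinner a b) F"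
  unfolding cinner_eq_Complex by (intro tendsto_intros assms)

lemma csubspaceD:
  assumes "csubspace M"
  shows "0 \<in> M" "x \<in> M \<Longrightarrow> y \<in> M \<Longrightarrow> x + y \<in> M" "x \<in> M \<Longrightarrow> y \<in> M \<Longrightarrow> x - y \<in> M"
    "x \<in> M \<Longrightarrow> c *\<^sub>C x \<in> M" "x \<in> M \<Longrightarrow> - x \<in> M" "x \<in> M \<Longrightarrow> r *\<^sub>R x \<in> M"
  using assms complex_space.subspace_diff[OF assms] complex_space.subspace_neg[OF assms]
  by (auto simp: complex_space.subspace_def scaleR_scaleC)

lemma closure_csubspace:
  assumes "csubspace M"
  shows "csubspace (closure M)"
  unfolding complex_space.subspace_def
proof (intro conjI ballI allI)
  show "0 \<in> closure M" using csubspaceD(1)[OF assms] closure_subset by blast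
next
  fix x y assume "x \<in> closure M" "y \<in> closure M"
  then obtain f g where "\<forall>n. f n \<in> M" "f \<longlonglongrightarrow> x" "\<forall>n. g n \<in> M" "g \<longlonglongrightarrow> y"
    by (auto simp: closure_sequential)
  then show "x + y \<in> closure M"
    unfolding closure_sequential
    by (intro exI[of _ "\<lambda>n. f n + g n"]) (auto intro!: tendsto_intros csubspaceD[OF assms])
next
  fix c x assume "x \<in> closure M"
  then obtain f where "\<forall>n. f n \<in> M" "f \<longlonglongrightarrow> x"
    by (auto simp: closure_sequential)
  then show "c *\<^sub>C x \<in> closure M"
    unfolding closure_sequential
    by (intro exI[of _ "\<lambda>n. c *\<^sub>C f n"]) (auto intro!: tendsto_intros csubspaceD[OF assms])
qed

section \<open>Bounded operators between carriers\<close>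

lemma bounded_opD:
  assumes "bounded_op M N T"
  shows "x \<in> M \<Longrightarrow> T x \<in> N" "x \<in> M \<Longrightarrow> y \<in> M \<Longrightarrow> T (x + y) = T x + T y"
    "x \<in> M \<Longrightarrow> T (c *\<^sub>C x) = c *\<^sub>C T x"
  using assms by (auto simp: bounded_op_def)

lemma bounded_op_more:
  assumes "bounded_op M N T" "csubspace M"
  shows "T 0 = 0" "x \<in> M \<Longrightarrow> y \<in> M \<Longrightarrow> T (x - y) = T x - T y"
    "x \<in> M \<Longrightarrow> T (- x) = - T x" "x \<in> M \<Longrightarrow> T (r *\<^sub>R x) = r *\<^sub>R T x"
proof -
  show "T 0 = 0"
    using bounded_opD(3)[OF assms(1), of 0 0] csubspaceD(1)[OF assms(2)] by simp
  show neg: "T (- x) = - T x" if "x \<in> M" for x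
    using bounded_opD(3)[OF assms(1) that, of "-1"] by simp
  show "T (x - y) = T x - T y" if "x \<in> M" "y \<in> M"
    using bounded_opD(2)[OF assms(1) that(1), of "- y"] that csubspaceD(5)[OF assms(2)] neg by simp
  show "T (r *\<^sub>R x) = r *\<^sub>R T x" if "x \<in> M"
    using bounded_opD(3)[OF assms(1) that] by (simp add: scaleR_scaleC)
qed

lemma bounded_op_bound:
  assumes "bounded_op M N T"
  obtains B where "B > 0" "\<And>x. x \<in> M \<Longrightarrow> norm (T x) \<le> B * norm x"
proof -
  obtain B where B: "\<forall>x\<in>M. norm (T x) \<le> B * norm x" using assms by (auto simp: bounded_op_def)
  have "norm (T x) \<le> (\<bar>B\<bar> + 1) * norm x" if "x \<in> M" for x
    using B that by (smt (verit) mult_right_mono norm_ge_zero)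
  then show ?thesis by (intro that[of "\<bar>B\<bar> + 1"]) auto
qed

lemma bounded_op_tendsto:
  assumes "bounded_op M N T" "csubspace M" "\<And>k. f k \<in> M" "l \<in> M" "f \<longlonglongrightarrow> l"
  shows "(\<lambda>k. T (f k)) \<longlonglongrightarrow> T l"
proof -
  obtain B where B: "\<And>x. x \<in> M \<Longrightarrow> norm (T x) \<le> B * norm x" using bounded_op_bound[OF assms(1)] by blast
  have "(\<lambda>k. T (f k) - T l) \<longlonglongrightarrow> 0"
  proof (rule Lim_null_comparison)
    show "\<forall>\<^sub>F k in sequentially. norm (T (f k) - T l) \<le> B * norm (f k - l)"
      using B csubspaceD(3)[OF assms(2)] assms(3,4) bounded_op_more(2)[OF assms(1,2)]
      by (metis (mono_tags, lifting) always_eventually)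
    show "(\<lambda>k. B * norm (f k - l)) \<longlonglongrightarrow> 0"
      using assms(5) by (intro tendsto_mult_right_zero tendsto_norm_zero LIM_zero)
  qed
  then show ?thesis by (simp add: LIM_zero_iff)
qed

lemma bounded_op_compose:
  assumes "bounded_op M N T" "bounded_op N N' T'"
  shows "bounded_op M N' (\<lambda>x. T' (T x))"
proof -
  obtain B where B: "\<And>x. x \<in> M \<Longrightarrow> norm (T x) \<le> B * norm x" using bounded_op_bound[OF assms(1)] by blast
  obtain B' where B': "B' > 0" "\<And>x. x \<in> N \<Longrightarrow> norm (T' x) \<le> B' * norm x"
    using bounded_op_bound[OF assms(2)] by blast
  have "norm (T' (T x)) \<le> (B' * B) * norm x" if "x \<in> M" for x
    using B[OF that] B'(2)[of "T x"] B'(1) bounded_opD(1)[OF assms(1) that]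
    by (smt (verit) mult.assoc mult_left_mono)
  then show ?thesis
    using bounded_opD[OF assms(1)] bounded_opD[OF assms(2)]
    unfolding bounded_op_def by (intro conjI) (auto intro!: exI[of _ "B' * B"])
qed

lemma bounded_op_id: "bounded_op M M (\<lambda>x. x)"
  by (auto simp: bounded_op_def intro!: exI[of _ 1])

lemma bounded_op_scaleC:
  assumes "bounded_op M N T" "csubspace N"
  shows "bounded_op M N (\<lambda>x. c *\<^sub>C T x)"
proof -
  obtain B where B: "\<And>x. x \<in> M \<Longrightarrow> norm (T x) \<le> B * norm x" using bounded_op_bound[OF assms(1)] by blast
  have "norm (c *\<^sub>C T x) \<le> (cmod c * B) * norm x" if "x \<in> M" for x
    using B[OF that] by (simp add: norm_scaleC mult.assoc mult_left_mono)
  then show ?thesis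
    using bounded_opD[OF assms(1)] csubspaceD[OF assms(2)]
    unfolding bounded_op_def
    by (intro conjI) (auto intro!: exI[of _ "cmod c * B"] simp: scaleC_add_right scaleC_scaleC mult.commute)
qed

lemma bounded_op_add:
  assumes "bounded_op M N T" "bounded_op M N T'" "csubspace N"
  shows "bounded_op M N (\<lambda>x. T x + T' x)"
proof -
  obtain B where B: "\<And>x. x \<in> M \<Longrightarrow> norm (T x) \<le> B * norm x" using bounded_op_bound[OF assms(1)] by blast
  obtain B' where B': "\<And>x. x \<in> M \<Longrightarrow> norm (T' x) \<le> B' * norm x"
    using bounded_op_bound[OF assms(2)] by blast
  have "norm (T x + T' x) \<le> (B + B') * norm x" if "x \<in> M" for x
    using B[OF that] B'[OF that] norm_triangle_ineq[of "T x" "T' x"] by (simp add: distrib_right)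
  then show ?thesis
    using bounded_opD[OF assms(1)] bounded_opD[OF assms(2)] csubspaceD[OF assms(3)]
    unfolding bounded_op_def
    by (intro conjI) (auto intro!: exI[of _ "B + B'"] simp: scaleC_add_right algebra_simps)
qed

lemma bounded_op_diff:
  assumes "bounded_op M N T" "bounded_op M N T'" "csubspace N"
  shows "bounded_op M N (\<lambda>x. T x - T' x)"
  using bounded_op_add[OF assms(1) bounded_op_scaleC[OF assms(2,3), of "-1"] assms(3)] by simp

text \<open>A minimizing sequence for the distance is Cauchy by the parallelogram law.\<close>

lemma nearest_point_exists:
  fixes M :: "'a::complex_hilbert_space set"
  assumes M: "csubspace M" "closed M"
  obtains y where "y \<in> M" "\<And>z. z \<in> M \<Longrightarrow> norm (x - y) \<le> norm (x - z)"
proof -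
  define d where "d = (INF z\<in>M. norm (x - z))"
  have ne: "M \<noteq> {}" using csubspaceD(1)[OF M(1)] by auto
  have bdd: "bdd_below ((\<lambda>z. norm (x - z)) ` M)" by (intro bdd_belowI2[where m=0]) simp
  have dle: "d \<le> norm (x - z)" if "z \<in> M" for z
    unfolding d_def using that bdd by (rule cINF_lower[rotated])
  have d0: "d \<ge> 0" unfolding d_def using ne by (intro cINF_greatest) auto
  have "\<exists>z\<in>M. norm (x - z) < d + 1 / (real k + 1)" for k
  proof -
    have "Inf ((\<lambda>z. norm (x - z)) ` M) < d + 1 / (real k + 1)" by (simp add: d_def)
    then show ?thesis using ne bdd by (subst (asm) cInf_less_iff) auto
  qed
  then obtain z where z: "\<And>k. z k \<in> M" "\<And>k. norm (x - z k) < d + 1 / (real k + 1)" by metis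
  have lim: "(\<lambda>k. norm (x - z k)) \<longlonglongrightarrow> d"
  proof (rule tendsto_sandwich)
    show "\<forall>\<^sub>F k in sequentially. d \<le> norm (x - z k)" using dle z(1) by simp
    show "\<forall>\<^sub>F k in sequentially. norm (x - z k) \<le> d + 1 / (real k + 1)" using z(2) by (intro always_eventually allI less_imp_le)
    show "(\<lambda>k. d + 1 / (real k + 1)) \<longlonglongrightarrow> d"
      using tendsto_add[OF tendsto_const[of d] LIMSEQ_inverse_real_of_nat]
      by (simp add: inverse_eq_divide add.commute)
  qed simp
  have par: "(norm (z i - z j))\<^sup>2 \<le> 2 * ((norm (x - z i))\<^sup>2 - d\<^sup>2) + 2 * ((norm (x - z j))\<^sup>2 - d\<^sup>2)" for i j
  proof -
    have "(1/2) *\<^sub>R (z i + z j) \<in> M" by (intro csubspaceD[OF M(1)] z(1))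
    then have "d\<^sup>2 \<le> (norm (x - (1/2) *\<^sub>R (z i + z j)))\<^sup>2" using dle d0 by (simp add: power_mono)
    moreover have "4 * (norm (x - (1/2) *\<^sub>R (z i + z j)))\<^sup>2 + (norm (z i - z j))\<^sup>2
        = 2 * (norm (x - z i))\<^sup>2 + 2 * (norm (x - z j))\<^sup>2"
    proof -
      define u v where "u = x - z i" and "v = x - z j"
      have "u + v = 2 *\<^sub>R (x - (1/2) *\<^sub>R (z i + z j))"
        by (simp add: u_def v_def scaleR_diff_right scaleR_2)
      then have "x - (1/2) *\<^sub>R (z i + z j) = (1/2) *\<^sub>R (u + v)" by simp
      moreover have "z i - z j = v - u" by (simp add: u_def v_def)
      ultimately show ?thesis
        unfolding u_def[symmetric] v_def[symmetric] power2_norm_eq_inner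
        by (simp add: inner_simps inner_commute[of v u]) (simp add: field_simps)
    qed
    ultimately show ?thesis by (simp add: algebra_simps)
  qed
  have "Cauchy z"
  proof (rule metric_CauchyI)
    fix e :: real assume e: "e > 0"
    have "(\<lambda>k. (norm (x - z k))\<^sup>2 - d\<^sup>2) \<longlonglongrightarrow> d\<^sup>2 - d\<^sup>2" by (intro tendsto_intros lim)
    then have "\<forall>\<^sub>F k in sequentially. (norm (x - z k))\<^sup>2 - d\<^sup>2 < e\<^sup>2 / 4"
      using e by (intro order_tendstoD(2)) auto
    then obtain N where N: "\<And>k. k \<ge> N \<Longrightarrow> (norm (x - z k))\<^sup>2 - d\<^sup>2 < e\<^sup>2 / 4"
      by (auto simp: eventually_sequentially)
    have "dist (z i) (z j) < e" if "i \<ge> N" "j \<ge> N" for i j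
    proof -
      note par[of i j]
      also have "2 * ((norm (x - z i))\<^sup>2 - d\<^sup>2) + 2 * ((norm (x - z j))\<^sup>2 - d\<^sup>2)
          < 2 * (e\<^sup>2 / 4) + 2 * (e\<^sup>2 / 4)"
        using N that by (intro add_strict_mono mult_strict_left_mono) auto
      finally have "(norm (z i - z j))\<^sup>2 < e\<^sup>2" by simp
      then show ?thesis using e by (simp add: dist_norm power2_less_imp_less)
    qed
    then show "\<exists>N. \<forall>i\<ge>N. \<forall>j\<ge>N. dist (z i) (z j) < e" by blast
  qed
  then obtain y where y: "z \<longlonglongrightarrow> y" using Cauchy_convergent convergent_def by blast
  show ?thesis
  proof (rule that)
    show "y \<in> M" using M(2) z(1) y closed_sequentially by blast
    have "(\<lambda>k. norm (x - z k)) \<longlonglongrightarrow> norm (x - y)" by (intro tendsto_intros y)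
    then have "norm (x - y) = d" using lim LIMSEQ_unique by blast
    then show "norm (x - y) \<le> norm (x - w)" if "w \<in> M" for w using dle that by simp
  qed
qed

lemma nearest_point_orthogonal:
  assumes M: "csubspace M" and y: "y \<in> M" "\<And>z. z \<in> M \<Longrightarrow> norm (x - y) \<le> norm (x - z)"
    and "w \<in> M"
  shows "cinner (x - y) w = 0"
proof -
  \<comment> \<open>The real part is enough: applied to \<open>\<i> *\<^sub>C w\<close> it also
    yields the imaginary part.\<close>
  have re: "inner (x - y) w = 0" if w: "w \<in> M" for w
  proof (rule ccontr)
    assume ne: "inner (x - y) w \<noteq> 0"
    then have w0: "norm w \<noteq> 0" by auto
    \<comment> \<open>The minimizer of the quadratic polynomial
      \<open>t \<mapsto> (norm (x - y - t *\<^sub>R w))\<^sup>2\<close>; moving from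
      \<open>y\<close> by this multiple of \<open>w\<close> would strictly reduce the
      distance.\<close>
    define t where "t = inner (x - y) w / (norm w)\<^sup>2"
    have "y + t *\<^sub>R w \<in> M" by (intro csubspaceD[OF M] y(1) w)
    then have "(norm (x - y))\<^sup>2 \<le> (norm (x - (y + t *\<^sub>R w)))\<^sup>2" using y(2) by (simp add: power_mono)
    also have "\<dots> = (norm ((x - y) - t *\<^sub>R w))\<^sup>2" by (simp only: diff_diff_eq)
    also have "\<dots> = (norm (x - y))\<^sup>2 - 2 * t * inner (x - y) w + t\<^sup>2 * (norm w)\<^sup>2"
    proof -
      have "(norm (u - t *\<^sub>R w))\<^sup>2 = (norm u)\<^sup>2 - 2 * t * inner u w + t\<^sup>2 * (norm w)\<^sup>2" for u
        unfolding power2_norm_eq_inner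
        by (simp add: inner_diff_left inner_diff_right inner_commute[of w u] power2_eq_square right_diff_distrib)
      then show ?thesis .
    qed
    also have "\<dots> = (norm (x - y))\<^sup>2 - (inner (x - y) w)\<^sup>2 / (norm w)\<^sup>2"
      using w0 by (simp add: t_def field_simps power2_eq_square)
    finally have "(inner (x - y) w)\<^sup>2 / (norm w)\<^sup>2 \<le> 0" by simp
    moreover have "(inner (x - y) w)\<^sup>2 / (norm w)\<^sup>2 > 0" using ne w0 by simp
    ultimately show False by linarith
  qed
  show ?thesis
    unfolding cinner_eq_Complex using re assms(4) csubspaceD(4)[OF M assms(4), of \<i>]
    by (simp add: complex_eq_iff)
qed

section \<open>Orthogonal projections, the Riesz representation and adjoints\<close>

lemma projection_exists:
  assumes "closed_csubspace M"
  obtains y where "y \<in> M" "\<And>w. w \<in> M \<Longrightarrow> cinner (x - y) w = 0"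
proof -
  have M: "csubspace M" "closed M" using assms by (auto simp: closed_csubspace_def)
  obtain y where y: "y \<in> M" "\<And>z. z \<in> M \<Longrightarrow> norm (x - y) \<le> norm (x - z)"
    using nearest_point_exists[OF M] by blast
  show ?thesis by (rule that[OF y(1)]) (rule nearest_point_orthogonal[OF M(1) y])
qed

lemma orth_proj:
  assumes M: "closed_csubspace M"
  shows "orth_proj M x \<in> M" "w \<in> M \<Longrightarrow> cinner (x - orth_proj M x) w = 0"
proof -
  have s: "csubspace M" using M by (simp add: closed_csubspace_def)
  have ex1: "\<exists>!y. y \<in> M \<and> x - y \<in> UNIV \<ominus>\<^sub>H M"
  proof -
    obtain y where y: "y \<in> M" "\<And>w. w \<in> M \<Longrightarrow> cinner (x - y) w = 0" using projection_exists[OF M, of x] by blast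
    have uniq: "z = y" if z: "z \<in> M" "\<forall>w\<in>M. cinner (x - z) w = 0" for z
    proof -
      have "z - y \<in> M" by (intro csubspaceD[OF s] y(1) z(1))
      then have "cinner (z - y) (z - y) = 0"
        using y(2)[of "z - y"] z(2) cinner_diff_left[of "x - y" "x - z" "z - y"] by simp
      then show ?thesis by (simp add: cinner_self)
    qed
    show ?thesis
      unfolding orth_diff_def
    proof (rule ex1I[of _ y])
      show "y \<in> M \<and> x - y \<in> {x \<in> UNIV. \<forall>y\<in>M. cinner x y = 0}" using y by simp
    qed (use uniq in blast)
  qed
  show "orth_proj M x \<in> M" "w \<in> M \<Longrightarrow> cinner (x - orth_proj M x) w = 0"
    using theI'[OF ex1] unfolding orth_proj_def orth_diff_def by auto
qed

lemma riesz_representation: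
  assumes M: "closed_csubspace M"
    and add: "\<And>x y. x \<in> M \<Longrightarrow> y \<in> M \<Longrightarrow> f (x + y) = f x + f y"
    and scale: "\<And>c x. x \<in> M \<Longrightarrow> f (c *\<^sub>C x) = c * f x"
    and bound: "\<And>x. x \<in> M \<Longrightarrow> cmod (f x) \<le> B * norm x"
  obtains z where "z \<in> M" "\<And>x. x \<in> M \<Longrightarrow> f x = cinner x z"
proof -
  have s: "csubspace M" and cl: "closed M" using M by (simp_all add: closed_csubspace_def)
  have diff: "f (x - y) = f x - f y" if "x \<in> M" "y \<in> M" for x y
    using add[of x "- y"] scale[of y "-1"] that csubspaceD(5)[OF s] by simp
  define Z where "Z = {x \<in> M. f x = 0}"
  have f0: "f 0 = 0" using scale[of 0 0] csubspaceD(1)[OF s] by simp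
  have Z: "closed_csubspace Z"
    unfolding closed_csubspace_def
  proof
    show "csubspace Z" unfolding complex_space.subspace_def Z_def
      using csubspaceD[OF s] add scale f0 by auto
    show "closed Z" unfolding closed_sequential_limits
    proof (intro allI impI, elim conjE)
      fix u l assume u: "\<forall>n. u n \<in> Z" "u \<longlonglongrightarrow> l"
      have l: "l \<in> M" using u cl closed_sequentially unfolding Z_def by blast
      have "cmod (f l) \<le> B * norm (l - u n)" for n
        using bound[of "l - u n"] diff[of l "u n"] u(1) l csubspaceD(3)[OF s] by (auto simp: Z_def)
      moreover have "(\<lambda>n. B * norm (l - u n)) \<longlonglongrightarrow> B * norm (l - l)" by (intro tendsto_intros u)
      ultimately have "cmod (f l) \<le> 0" by (intro LIMSEQ_le_const) auto
      then show "l \<in> Z" using l by (simp add: Z_def)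
    qed
  qed
  show ?thesis
  proof (cases "\<exists>e\<in>M. f e \<noteq> 0")
    case False
    then show ?thesis using csubspaceD(1)[OF s] by (intro that[of 0]) auto
  next
    case True
    then obtain e0 where e0: "e0 \<in> M" "f e0 \<noteq> 0" by blast
    obtain y where y: "y \<in> Z" "\<And>w. w \<in> Z \<Longrightarrow> cinner (e0 - y) w = 0" using projection_exists[OF Z, of e0] by blast
    \<comment> \<open>Removing the projection onto the kernel \<open>Z\<close> keeps the value of
      \<open>f\<close> and makes \<open>e\<close> orthogonal to \<open>Z\<close>; modulo
      \<open>Z\<close>, every vector is a multiple of \<open>e\<close>.\<close>
    define e where "e = e0 - y"
    have e: "e \<in> M" "f e = f e0" using e0 y csubspaceD(3)[OF s] diff by (auto simp: e_def Z_def)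
    have ne: "e \<noteq> 0" using e e0 f0 by auto
    \<comment> \<open>The scalar is dictated by \<open>f e = cinner e z\<close>.\<close>
    define z where "z = cnj (f e / (norm e)\<^sup>2) *\<^sub>C e"
    have "f x = cinner x z" if x: "x \<in> M" for x
    proof -
      have "x - (f x / f e) *\<^sub>C e \<in> Z"
        using x e e0(2) csubspaceD[OF s] scale diff by (simp add: Z_def)
      from y(2)[OF this] have "cinner e x = cnj (f x / f e) * cinner e e"
        by (simp add: e_def[symmetric] cinner_simps)
      then have "cinner x e = (f x / f e) * cinner e e"
        by (metis cinner_commute complex_cnj_cnj complex_cnj_mult)
      then show ?thesis using ne e e0(2) by (simp add: z_def cinner_simps cinner_self)
    qed
    moreover have "z \<in> M" using e csubspaceD(4)[OF s] by (simp add: z_def)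
    ultimately show ?thesis using that by blast
  qed
qed

lemma hadjoint_eqI:
  assumes "csubspace M" "z \<in> M" "\<And>x. x \<in> M \<Longrightarrow> cinner (T x) y = cinner x z"
  shows "hadjoint M T y = z"
  unfolding hadjoint_def
proof (rule the_equality)
  fix w assume w: "w \<in> M \<and> (\<forall>x\<in>M. cinner (T x) y = cinner x w)"
  then have "w - z \<in> M" by (intro csubspaceD(3)[OF assms(1)] assms(2)) simp
  then have "cinner (w - z) (w - z) = 0"
    using w assms(3)[of "w - z"] by (simp add: cinner_diff_right)
  then show "w = z" by (simp add: cinner_self)
qed (use assms in blast)

lemma hadjoint:
  assumes M: "closed_csubspace M" and T: "bounded_op M N T"
  shows "hadjoint M T y \<in> M" "x \<in> M \<Longrightarrow> cinner (T x) y = cinner x (hadjoint M T y)"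
proof -
  have s: "csubspace M" using M by (simp add: closed_csubspace_def)
  obtain B where B: "B > 0" "\<And>x. x \<in> M \<Longrightarrow> norm (T x) \<le> B * norm x" using bounded_op_bound[OF T] by blast
  obtain z where z: "z \<in> M" "\<And>x. x \<in> M \<Longrightarrow> cinner (T x) y = cinner x z"
  proof (rule riesz_representation[OF M, of "\<lambda>x. cinner (T x) y" "B * norm y"])
    show "cmod (cinner (T x) y) \<le> B * norm y * norm x" if "x \<in> M" for x
      using cinner_norm_le[of "T x" y] B(2)[OF that] mult_right_mono[OF B(2)[OF that], of "norm y"]
      by (simp add: mult.assoc mult.commute mult.left_commute)
  qed (use bounded_opD[OF T] in \<open>auto simp: cinner_simps\<close>)
  then show "hadjoint M T y \<in> M" "x \<in> M \<Longrightarrow> cinner (T x) y = cinner x (hadjoint M T y)"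
    using hadjoint_eqI[OF s z] by auto
qed

text \<open>The domain is the whole type because \<open>x \<mapsto> cinner (T x) y\<close> is a
  bounded functional on \<open>M\<close> for every \<open>y\<close>, inside \<open>N\<close> or not.
  The bound comes from testing the adjoint identity at \<open>hadjoint M T y\<close> itself.\<close>

lemma bounded_op_hadjoint:
  assumes M: "closed_csubspace M" and T: "bounded_op M N T"
  shows "bounded_op UNIV M (hadjoint M T)"
proof -
  have s: "csubspace M" using M by (simp add: closed_csubspace_def)
  note h = hadjoint[OF M T]
  obtain B where B: "B > 0" "\<And>x. x \<in> M \<Longrightarrow> norm (T x) \<le> B * norm x" using bounded_op_bound[OF T] by blast
  have bnd: "norm (hadjoint M T y) \<le> B * norm y" for y
  proof (cases "norm (hadjoint M T y) = 0")
    case False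
    let ?z = "hadjoint M T y"
    have "norm ?z * norm ?z = cmod (cinner ?z ?z)" by (simp add: cinner_self norm_mult power2_eq_square)
    also have "\<dots> = cmod (cinner (T ?z) y)" using h by simp
    also have "\<dots> \<le> norm (T ?z) * norm y" by (rule cinner_norm_le)
    also have "\<dots> \<le> B * norm ?z * norm y" using B h(1) by (intro mult_right_mono) auto
    finally show ?thesis using False by (simp add: mult.commute mult.left_commute)
  qed (use B in simp)
  have "hadjoint M T (x + y) = hadjoint M T x + hadjoint M T y" for x y
    using h csubspaceD(2)[OF s] by (intro hadjoint_eqI[OF s]) (auto simp: cinner_simps)
  moreover have "hadjoint M T (c *\<^sub>C x) = c *\<^sub>C hadjoint M T x" for c x
    using h csubspaceD(4)[OF s] by (intro hadjoint_eqI[OF s]) (auto simp: cinner_simps)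
  ultimately show ?thesis using h(1) bnd unfolding bounded_op_def by auto
qed

section \<open>Approximate eigenvectors of commuting normal operators\<close>

text \<open>The adjoint is carried along as an explicit operator, so that adjoints of sums, products
  and shifts are written down directly instead of being computed from the description in
  \<open>hadjoint\<close>.\<close>

definition adj_pair ::
  "'a::complex_hilbert_space set \<Rightarrow> ('a \<Rightarrow> 'a) \<Rightarrow> ('a \<Rightarrow> 'a) \<Rightarrow> bool" where
  "adj_pair L T T' \<longleftrightarrow> bounded_op L L T \<and> bounded_op L L T' \<and>
     (\<forall>x\<in>L. \<forall>y\<in>L. cinner (T x) y = cinner x (T' y))"

definition normal_pair ::
  "'a::complex_hilbert_space set \<Rightarrow> ('a \<Rightarrow> 'a) \<Rightarrow> ('a \<Rightarrow> 'a) \<Rightarrow> bool" where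
  "normal_pair L T T' \<longleftrightarrow> adj_pair L T T' \<and> (\<forall>x\<in>L. T' (T x) = T (T' x))"

lemma adj_pairD:
  assumes "adj_pair L T T'"
  shows "bounded_op L L T" "bounded_op L L T'"
    "x \<in> L \<Longrightarrow> T x \<in> L" "x \<in> L \<Longrightarrow> T' x \<in> L"
    "x \<in> L \<Longrightarrow> y \<in> L \<Longrightarrow> cinner (T x) y = cinner x (T' y)"
    "x \<in> L \<Longrightarrow> y \<in> L \<Longrightarrow> cinner (T' x) y = cinner x (T y)"
proof -
  show "bounded_op L L T" "bounded_op L L T'" and 1: "x \<in> L \<Longrightarrow> y \<in> L \<Longrightarrow> cinner (T x) y = cinner x (T' y)" for x y
    using assms by (auto simp: adj_pair_def)
  then show "x \<in> L \<Longrightarrow> T x \<in> L" "x \<in> L \<Longrightarrow> T' x \<in> L" by (auto simp: bounded_op_def)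
  show "x \<in> L \<Longrightarrow> y \<in> L \<Longrightarrow> cinner (T' x) y = cinner x (T y)" for x y
    using 1 by (metis cinner_commute)
qed

lemma adj_pair_sym: "adj_pair L T T' \<Longrightarrow> adj_pair L T' T"
  using adj_pairD[of L T T'] unfolding adj_pair_def by blast

lemma normal_pairD:
  assumes "normal_pair L T T'"
  shows "adj_pair L T T'" "x \<in> L \<Longrightarrow> T' (T x) = T (T' x)"
  using assms by (auto simp: normal_pair_def)

lemma adj_pair_add:
  assumes "csubspace L" "adj_pair L T T'" "adj_pair L U U'"
  shows "adj_pair L (\<lambda>x. T x + U x) (\<lambda>x. T' x + U' x)"
  using assms bounded_op_add unfolding adj_pair_def by (auto simp: cinner_simps)

lemma adj_pair_diff:
  assumes "csubspace L" "adj_pair L T T'" "adj_pair L U U'"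
  shows "adj_pair L (\<lambda>x. T x - U x) (\<lambda>x. T' x - U' x)"
  using assms bounded_op_diff unfolding adj_pair_def by (auto simp: cinner_simps)

lemma adj_pair_scaleC:
  assumes "csubspace L" "adj_pair L T T'"
  shows "adj_pair L (\<lambda>x. c *\<^sub>C T x) (\<lambda>x. cnj c *\<^sub>C T' x)"
  using assms bounded_op_scaleC unfolding adj_pair_def by (auto simp: cinner_simps)

lemma adj_pair_id: "adj_pair L (\<lambda>x. x) (\<lambda>x. x)"
  by (auto simp: adj_pair_def bounded_op_id)

lemma adj_pair_compose:
  assumes "adj_pair L T T'" "adj_pair L U U'"
  shows "adj_pair L (\<lambda>x. T (U x)) (\<lambda>x. U' (T' x))"
  using adj_pairD[OF assms(1)] adj_pairD[OF assms(2)] bounded_op_compose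
  unfolding adj_pair_def by fastforce

lemma adj_pair_shift:
  assumes "csubspace L" "adj_pair L T T'"
  shows "adj_pair L (\<lambda>x. T x - c *\<^sub>C x) (\<lambda>x. T' x - cnj c *\<^sub>C x)"
  by (intro adj_pair_diff adj_pair_scaleC adj_pair_id assms)

lemma cinner_eqI:
  assumes "csubspace L" "x \<in> L" "y \<in> L" "\<And>w. w \<in> L \<Longrightarrow> cinner x w = cinner y w"
  shows "x = y"
proof -
  have "cinner (x - y) (x - y) = 0"
    using assms(4)[OF csubspaceD(3)[OF assms(1-3)]] by (simp add: cinner_diff_left[of x y])
  then show ?thesis by (simp add: cinner_self)
qed

lemma adj_pair_commute:
  assumes L: "csubspace L" and T: "adj_pair L T T'" and N: "adj_pair L N N'"
    and c: "\<And>x. x \<in> L \<Longrightarrow> T (N x) = N (T x)" and x: "x \<in> L"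
  shows "T' (N' x) = N' (T' x)"
proof (rule cinner_eqI[OF L])
  fix w assume w: "w \<in> L"
  have "cinner (T' (N' x)) w = cinner x (N (T w))"
    using adj_pairD[OF T] adj_pairD[OF N] w x by simp
  also have "\<dots> = cinner x (T (N w))" using c[OF w] by simp
  also have "\<dots> = cinner (N' (T' x)) w"
    using adj_pairD[OF T] adj_pairD[OF N] w x by simp
  finally show "cinner (T' (N' x)) w = cinner (N' (T' x)) w" .
qed (use adj_pairD[OF T] adj_pairD[OF N] x in auto)

lemma normal_pair_shift:
  assumes L: "csubspace L" and T: "normal_pair L T T'"
  shows "normal_pair L (\<lambda>x. T x - c *\<^sub>C x) (\<lambda>x. T' x - cnj c *\<^sub>C x)"
  unfolding normal_pair_def
proof
  note a = normal_pairD(1)[OF T]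
  show "adj_pair L (\<lambda>x. T x - c *\<^sub>C x) (\<lambda>x. T' x - cnj c *\<^sub>C x)"
    by (rule adj_pair_shift[OF L a])
  show "\<forall>x\<in>L. T' (T x - c *\<^sub>C x) - cnj c *\<^sub>C (T x - c *\<^sub>C x)
      = T (T' x - cnj c *\<^sub>C x) - c *\<^sub>C (T' x - cnj c *\<^sub>C x)"
  proof
    fix x assume x: "x \<in> L"
    have m: "T x \<in> L" "T' x \<in> L" "\<And>d. d *\<^sub>C x \<in> L"
      using adj_pairD[OF a] csubspaceD(4)[OF L] x by auto
    show "T' (T x - c *\<^sub>C x) - cnj c *\<^sub>C (T x - c *\<^sub>C x)
        = T (T' x - cnj c *\<^sub>C x) - c *\<^sub>C (T' x - cnj c *\<^sub>C x)"
      using normal_pairD(2)[OF T x]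
      by (simp add: bounded_op_more(2)[OF adj_pairD(1)[OF a] L] bounded_op_more(2)[OF adj_pairD(2)[OF a] L] m
          bounded_opD(3)[OF adj_pairD(1)[OF a] x] bounded_opD(3)[OF adj_pairD(2)[OF a] x]
          scaleC_diff_right scaleC_scaleC mult.commute)
  qed
qed

lemma normal_pair_norm:
  assumes T: "normal_pair L T T'" and x: "x \<in> L"
  shows "norm (T' x) = norm (T x)"
proof -
  note a = adj_pairD[OF normal_pairD(1)[OF T]]
  have "cinner (T' x) (T' x) = cinner x (T (T' x))" using a x by simp
  also have "\<dots> = cinner x (T' (T x))" using normal_pairD(2)[OF T x] by simp
  also have "\<dots> = cinner (T x) (T x)" using a x by simp
  finally show ?thesis unfolding cinner_self of_real_eq_iff by (simp add: power2_eq_iff_nonneg)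
qed

lemma normal_op_pair:
  assumes L: "closed_csubspace L" and T: "normal_op L T"
  shows "normal_pair L T (hadjoint L T)"
proof -
  have b: "bounded_op L L T" using T by (simp add: normal_op_def)
  have "bounded_op L L (hadjoint L T)"
    using bounded_op_hadjoint[OF L b] unfolding bounded_op_def by auto
  then show ?thesis
    using b T hadjoint[OF L b] by (auto simp: normal_pair_def adj_pair_def normal_op_def)
qed

section \<open>Seminorms in the role of approximate eigenspaces\<close>

definition seminorm_on :: "'a::complex_hilbert_space set \<Rightarrow> ('a \<Rightarrow> real) \<Rightarrow> bool" where
  "seminorm_on L g \<longleftrightarrow> (\<forall>x\<in>L. \<forall>y\<in>L. g (x + y) \<le> g x + g y) \<and> (\<forall>c. \<forall>x\<in>L. g (c *\<^sub>C x) = cmod c * g x)"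

text \<open>A seminorm \<open>g\<close> stands for a subspace that may contain no actual nonzero
  vector: what counts are the unit vectors at which \<open>g\<close> is small.
  \<open>approx_null\<close> says that this ideal subspace is nonzero, \<open>stable_under\<close>
  that an operator maps it into itself, and adding seminorms corresponds to intersecting. The
  approximate eigenspace of \<open>T\<close> at \<open>c\<close> is
  \<open>resid T c\<close>.\<close>

definition approx_null :: "'a::complex_hilbert_space set \<Rightarrow> ('a \<Rightarrow> real) \<Rightarrow> bool" where
  "approx_null L g \<longleftrightarrow> (\<forall>e>0. \<exists>x\<in>L. norm x = 1 \<and> g x < e)"

definition stable_under :: "'a::complex_hilbert_space set \<Rightarrow> ('a \<Rightarrow> real) \<Rightarrow> ('a \<Rightarrow> 'a) \<Rightarrow> bool" where
  "stable_under L g T \<longleftrightarrow> (\<exists>C. \<forall>x\<in>L. g (T x) \<le> C * g x)"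

definition resid :: "('a \<Rightarrow> 'a) \<Rightarrow> complex \<Rightarrow> 'a::complex_hilbert_space \<Rightarrow> real" where
  "resid T c x = norm (T x - c *\<^sub>C x)"

lemma seminorm_nonneg:
  assumes "seminorm_on L g" "csubspace L" "x \<in> L"
  shows "g x \<ge> 0"
proof -
  have "g (x + - x) \<le> g x + g (- x)"
    using assms(1,3) csubspaceD(5)[OF assms(2,3)] unfolding seminorm_on_def by blast
  moreover have "g (- x) = g x"
    using assms scaleC_minus1[of x] by (metis norm_minus_cancel norm_one mult_1 seminorm_on_def)
  moreover have "g (0 *\<^sub>C x) = cmod 0 * g x" using assms unfolding seminorm_on_def by blast
  ultimately show ?thesis by simp
qed

lemma stable_underE:
  assumes "stable_under L g T" "seminorm_on L g" "csubspace L"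
  obtains C where "C > 0" "\<And>x. x \<in> L \<Longrightarrow> g (T x) \<le> C * g x"
proof -
  obtain C where C: "\<And>x. x \<in> L \<Longrightarrow> g (T x) \<le> C * g x" using assms(1) by (auto simp: stable_under_def)
  have "g (T x) \<le> (\<bar>C\<bar> + 1) * g x" if "x \<in> L" for x
    using C[OF that] seminorm_nonneg[OF assms(2,3) that] by (smt (verit) mult_right_mono)
  then show ?thesis by (intro that[of "\<bar>C\<bar> + 1"]) auto
qed

lemma seminorm_zero: "seminorm_on L (\<lambda>x. 0)"
  by (simp add: seminorm_on_def)

lemma seminorm_add:
  "seminorm_on L g \<Longrightarrow> seminorm_on L h \<Longrightarrow> seminorm_on L (\<lambda>x. g x + h x)"
  unfolding seminorm_on_def
proof (elim conjE, intro conjI ballI allI)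
  assume "\<forall>x\<in>L. \<forall>y\<in>L. g (x + y) \<le> g x + g y" "\<forall>x\<in>L. \<forall>y\<in>L. h (x + y) \<le> h x + h y"
  then show "g (x + y) + h (x + y) \<le> g x + h x + (g y + h y)" if "x \<in> L" "y \<in> L" for x y
    using that by (smt (verit))
qed (simp add: distrib_left)

lemma seminorm_sum:
  "finite J \<Longrightarrow> (\<And>j. j \<in> J \<Longrightarrow> seminorm_on L (g j)) \<Longrightarrow> seminorm_on L (\<lambda>x. \<Sum>j\<in>J. g j x)"
  by (induction J rule: finite_induct) (auto intro: seminorm_zero seminorm_add)

lemma seminorm_resid:
  assumes T: "bounded_op L L T" and L: "csubspace L"
  shows "seminorm_on L (resid T c)"
  unfolding seminorm_on_def resid_def
proof (intro conjI ballI allI)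
  fix x y assume "x \<in> L" "y \<in> L"
  then have "T (x + y) - c *\<^sub>C (x + y) = (T x - c *\<^sub>C x) + (T y - c *\<^sub>C y)"
    by (simp add: bounded_opD(2)[OF T] scaleC_add_right)
  then show "norm (T (x + y) - c *\<^sub>C (x + y)) \<le> norm (T x - c *\<^sub>C x) + norm (T y - c *\<^sub>C y)"
    by (metis norm_triangle_ineq)
next
  fix d x assume "x \<in> L"
  then have "T (d *\<^sub>C x) - c *\<^sub>C d *\<^sub>C x = d *\<^sub>C (T x - c *\<^sub>C x)"
    by (simp add: bounded_opD(3)[OF T] scaleC_diff_right scaleC_scaleC mult.commute)
  then show "norm (T (d *\<^sub>C x) - c *\<^sub>C d *\<^sub>C x) = cmod d * norm (T x - c *\<^sub>C x)"
    by (simp add: norm_scaleC)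
qed

lemma stable_zero: "stable_under L (\<lambda>x. 0) T"
  by (simp add: stable_under_def)

lemma stable_add:
  assumes "stable_under L g T" "stable_under L h T" "seminorm_on L g" "seminorm_on L h" "csubspace L"
  shows "stable_under L (\<lambda>x. g x + h x) T"
proof -
  obtain C where C: "C > 0" "\<And>x. x \<in> L \<Longrightarrow> g (T x) \<le> C * g x" using stable_underE[OF assms(1,3,5)] by blast
  obtain D where D: "D > 0" "\<And>x. x \<in> L \<Longrightarrow> h (T x) \<le> D * h x" using stable_underE[OF assms(2,4,5)] by blast
  have "g (T x) + h (T x) \<le> (C + D) * (g x + h x)" if "x \<in> L" for x
  proof -
    have "0 \<le> C * h x" "0 \<le> D * g x" using C D seminorm_nonneg[OF _ assms(5) that] assms(3,4) by auto
    then show ?thesis using C(2)[OF that] D(2)[OF that] by (simp add: distrib_left distrib_right)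
  qed
  then show ?thesis by (auto simp: stable_under_def)
qed

lemma stable_combination:
  assumes "stable_under L g T" "stable_under L g U" "seminorm_on L g" "csubspace L"
    and "\<And>x. x \<in> L \<Longrightarrow> T x \<in> L" "\<And>x. x \<in> L \<Longrightarrow> U x \<in> L"
  shows "stable_under L g (\<lambda>x. a *\<^sub>C T x + b *\<^sub>C U x)"
proof -
  obtain C where C: "C > 0" "\<And>x. x \<in> L \<Longrightarrow> g (T x) \<le> C * g x" using stable_underE[OF assms(1,3,4)] by blast
  obtain D where D: "D > 0" "\<And>x. x \<in> L \<Longrightarrow> g (U x) \<le> D * g x" using stable_underE[OF assms(2,3,4)] by blast
  have "g (a *\<^sub>C T x + b *\<^sub>C U x) \<le> (cmod a * C + cmod b * D) * g x" if "x \<in> L" for x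
  proof -
    have "g (a *\<^sub>C T x + b *\<^sub>C U x) \<le> cmod a * g (T x) + cmod b * g (U x)"
      using assms(3,5,6) csubspaceD(4)[OF assms(4)] that unfolding seminorm_on_def by metis
    also have "\<dots> \<le> cmod a * (C * g x) + cmod b * (D * g x)"
      using C D that by (intro add_mono mult_left_mono) auto
    finally show ?thesis by (simp add: distrib_right mult.assoc)
  qed
  then show ?thesis by (auto simp: stable_under_def)
qed

lemma stable_resid:
  assumes "bounded_op L L T" and "bounded_op L L N" and "csubspace L"
    and "\<And>x. x \<in> L \<Longrightarrow> T (N x) = N (T x)"
  shows "stable_under L (resid T c) N"
proof -
  obtain B where B: "\<And>x. x \<in> L \<Longrightarrow> norm (N x) \<le> B * norm x" using bounded_op_bound[OF assms(2)] by blast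
  have "resid T c (N x) \<le> B * resid T c x" if x: "x \<in> L" for x
  proof -
    have m: "T x \<in> L" "c *\<^sub>C x \<in> L" using bounded_opD(1)[OF assms(1)] csubspaceD(4)[OF assms(3)] x by auto
    have "T (N x) - c *\<^sub>C N x = N (T x - c *\<^sub>C x)"
      using assms(4)[OF x] bounded_op_more(2)[OF assms(2,3)] bounded_opD(3)[OF assms(2) x] m by simp
    then show ?thesis using B csubspaceD(3)[OF assms(3)] m by (simp add: resid_def)
  qed
  then show ?thesis by (auto simp: stable_under_def)
qed

lemma resid_adjoint:
  assumes "csubspace L" "normal_pair L T T'" "x \<in> L"
  shows "resid T' (cnj c) x = resid T c x"
  using normal_pair_norm[OF normal_pair_shift[OF assms(1,2)] assms(3), of c] by (simp add: resid_def)

text \<open>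
  Normality of \<open>T\<close> replaces Fuglede's theorem: \<open>N'\<close> commutes with \<open>T'\<close>, whose residuals are those of \<open>T\<close>.
\<close>

lemma stable_resid_adjoint:
  assumes L: "csubspace L" and T: "normal_pair L T T'" and N: "adj_pair L N N'"
    and c: "\<And>x. x \<in> L \<Longrightarrow> T (N x) = N (T x)"
  shows "stable_under L (resid T c) N'"
proof -
  note a = normal_pairD(1)[OF T]
  have "stable_under L (resid T' (cnj c)) N'"
    using adj_pair_commute[OF L a N c] by (intro stable_resid adj_pairD[OF a] adj_pairD[OF N] L) auto
  then show ?thesis
    using resid_adjoint[OF L T] adj_pairD(4)[OF N] by (auto simp: stable_under_def)
qed

lemma approx_null_mono:
  assumes "approx_null L g" "\<And>x. x \<in> L \<Longrightarrow> norm x = 1 \<Longrightarrow> h x \<le> C * g x" "C > 0"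
  shows "approx_null L h"
  unfolding approx_null_def
proof (intro allI impI)
  fix e :: real assume e: "e > 0"
  then have "e / C > 0" using assms(3) by simp
  then obtain x where x: "x \<in> L" "norm x = 1" "g x < e / C"
    using assms(1) unfolding approx_null_def by blast
  have "h x \<le> C * g x" using assms(2) x by blast
  also have "\<dots> < e" using x(3) assms(3) by (simp add: pos_less_divide_eq mult.commute)
  finally show "\<exists>x\<in>L. norm x = 1 \<and> h x < e" using x by blast
qed

text \<open>This is how contradictions and equalities between eigenvalues are drawn from approximate
  eigenvectors.\<close>

lemma approx_null_imp_zero:
  fixes r :: real
  assumes "approx_null L g" "\<And>x. x \<in> L \<Longrightarrow> norm x = 1 \<Longrightarrow> r \<le> C * g x" "C > 0"
  shows "r \<le> 0"
proof (rule ccontr)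
  assume "\<not> r \<le> 0"
  moreover have "approx_null L (\<lambda>x. r)" by (rule approx_null_mono[OF assms])
  ultimately show False unfolding approx_null_def by (metis less_irrefl not_le_imp_less)
qed

text \<open>
  Take \<open>c\<close> as the supremum of the quadratic form of \<open>B\<close> on unit vectors with \<open>g\<close> small.  If \<open>x\<close>
  nearly attains it and \<open>z = B x - c x\<close>, then moving from \<open>x\<close> to \<open>x + t z\<close> would raise the
  form by about \<open>2 t |z|\<^sup>2\<close>, so \<open>z\<close> is small.
\<close>

lemma selfadjoint_approx_eigenvalue:
  assumes L: "csubspace L" and B: "adj_pair L B B" and g: "seminorm_on L g" and st: "stable_under L g B"
    and t0: "\<And>e. e > 0 \<Longrightarrow> \<exists>x\<in>L. norm x = 1 \<and> g x < e \<and> inner (B x) x \<ge> t0"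
  obtains c :: real where "c \<ge> t0" "approx_null L (\<lambda>x. g x + resid B c x)"
proof -
  note b = adj_pairD[OF B]
  obtain \<beta> where \<beta>: "\<beta> > 0" "\<And>x. x \<in> L \<Longrightarrow> norm (B x) \<le> \<beta> * norm x" using bounded_op_bound[OF b(1)] by blast
  obtain C where C: "C > 0" "\<And>x. x \<in> L \<Longrightarrow> g (B x) \<le> C * g x" using stable_underE[OF st g L] by blast
  \<comment> \<open>\<open>Sup X\<close> is the limit, as \<open>e\<close> decreases to 0, of the
    supremum of the form over the unit vectors with \<open>g x < e\<close>.\<close>
  define X where "X = {t. \<forall>e>0. \<exists>x\<in>L. norm x = 1 \<and> g x < e \<and> inner (B x) x > t}"
  have q\<beta>: "inner (B x) x \<le> \<beta>" if "x \<in> L" "norm x = 1" for x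
    using norm_cauchy_schwarz[of "B x" x] \<beta>(2)[OF that(1)] that(2) by simp
  have low: "t \<in> X" if "t < t0" for t
    unfolding X_def using t0 that by (force intro: less_le_trans)
  have bdd: "bdd_above X"
  proof (rule bdd_aboveI)
    fix t assume "t \<in> X"
    then obtain x where "x \<in> L" "norm x = 1" "inner (B x) x > t" unfolding X_def using zero_less_one by blast
    then show "t \<le> \<beta>" using q\<beta> by fastforce
  qed
  have ne: "X \<noteq> {}" using low[of "t0 - 1"] by auto
  define c where "c = Sup X"
  have c_t0: "c \<ge> t0"
    unfolding c_def using low bdd by (meson cSup_upper dense_le)
  have above: "\<exists>x\<in>L. norm x = 1 \<and> g x < e \<and> inner (B x) x > c - \<eta>" if "e > 0" "\<eta> > 0" for e \<eta>
  proof -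
    have "c - \<eta> < Sup X" using that(2) by (simp add: c_def)
    then obtain t where "t \<in> X" "c - \<eta> < t" using ne less_cSupE by blast
    then show ?thesis using that(1) unfolding X_def by fastforce
  qed
  have below: "\<exists>e>0. \<forall>x\<in>L. norm x = 1 \<longrightarrow> g x < e \<longrightarrow> inner (B x) x \<le> c + \<eta>" if "\<eta> > 0" for \<eta>
  proof -
    have "c + \<eta> \<notin> X" using that cSup_upper[OF _ bdd, of "c + \<eta>"] by (auto simp: c_def)
    then obtain e where "e > 0" "\<And>x. x \<in> L \<Longrightarrow> norm x = 1 \<Longrightarrow> g x < e \<Longrightarrow> \<not> inner (B x) x > c + \<eta>"
      unfolding X_def by blast
    then show ?thesis by (meson not_less)
  qed
  define K where "K = \<beta> + \<bar>c\<bar> + 1"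
  have K: "K > 0" using \<beta> by (simp add: K_def)
  define F where "F x = B x - c *\<^sub>R x" for x
  have FL: "F x \<in> L" if "x \<in> L" for x using b(3) that csubspaceD[OF L] by (simp add: F_def)
  have Fbound: "norm (F x) \<le> K * norm x" if "x \<in> L" for x
  proof -
    have "norm (F x) \<le> norm (B x) + \<bar>c\<bar> * norm x"
      unfolding F_def using norm_triangle_ineq4[of "B x" "c *\<^sub>R x"] by simp
    also have "\<dots> \<le> \<beta> * norm x + \<bar>c\<bar> * norm x" using \<beta>(2)[OF that] by simp
    also have "\<dots> \<le> K * norm x" by (simp add: K_def distrib_right)
    finally show ?thesis .
  qed
  have Fadd: "F (x + r *\<^sub>R y) = F x + r *\<^sub>R F y" if "x \<in> L" "y \<in> L" for x y r
    using that bounded_opD(2)[OF b(1)] bounded_op_more(4)[OF b(1) L] csubspaceD(6)[OF L]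
    by (simp add: F_def scaleR_add_right scaleR_diff_right mult.commute)
  have Fsym: "inner (F x) y = inner x (F y)" if "x \<in> L" "y \<in> L" for x y
    using b(5)[OF that] by (simp add: F_def inner_diff_left inner_diff_right inner_eq_Re_cinner[of "B x"]
        inner_eq_Re_cinner[of _ "B y"])
  \<comment> \<open>With this step length \<open>t *\<^sub>R z\<close> has norm at most 1/2, so that
    \<open>y\<close> stays away from 0, and the quadratic term of the form at \<open>y\<close> is at
    most half of \<open>t * (norm z)\<^sup>2\<close>, too small to cancel the linear gain
    \<open>2 * t * (norm z)\<^sup>2\<close>.\<close>
  define t where "t = 1 / (2 * K)"
  have t: "t > 0" "t * K = 1/2" using K by (auto simp: t_def)
  have gF: "g (F x) \<le> (C + \<bar>c\<bar>) * g x" if x: "x \<in> L" for x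
  proof -
    have "g (F x) = g (B x + complex_of_real (- c) *\<^sub>C x)" by (simp add: F_def scaleR_scaleC)
    also have "\<dots> \<le> g (B x) + cmod (complex_of_real (- c)) * g x"
      using g b(3)[OF x] csubspaceD(4)[OF L x] x unfolding seminorm_on_def by metis
    also have "\<dots> \<le> (C + \<bar>c\<bar>) * g x" using C(2)[OF x] by (simp add: distrib_right)
    finally show ?thesis .
  qed
  have "approx_null L (\<lambda>x. g x + resid B c x)"
    unfolding approx_null_def
  proof (intro allI impI)
    fix e :: real assume e: "e > 0"
    \<comment> \<open>The form of \<open>F\<close> at \<open>y\<close> is at most
      \<open>4 * \<eta>\<close> and exceeds \<open>t * (norm z)\<^sup>2 - \<eta>\<close>. Hence
      \<open>t * (norm z)\<^sup>2 < 6 * \<eta>\<close>, and the right-hand side is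
      \<open>t * (e/2)\<^sup>2\<close>.\<close>
    define \<eta> where "\<eta> = t * (e/2)\<^sup>2 / 6"
    have \<eta>: "\<eta> > 0" using t e by (simp add: \<eta>_def)
    obtain e0 where e0: "e0 > 0" "\<And>x. x \<in> L \<Longrightarrow> norm x = 1 \<Longrightarrow> g x < e0 \<Longrightarrow> inner (B x) x \<le> c + \<eta>"
      using below[OF \<eta>] by blast
    define D where "D = 1 + t * (C + \<bar>c\<bar>)"
    have D: "D > 0" using t C by (simp add: D_def add_pos_nonneg)
    \<comment> \<open>\<open>e/2\<close> serves the final sum. The other bound keeps the normalized
      vector \<open>u\<close> in the region where \<open>below\<close> applies: passing from
      \<open>x\<close> to \<open>y\<close> multiplies \<open>g\<close> by at most \<open>D\<close>,
      and normalizing costs at most another factor 2.\<close>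
    define e1 where "e1 = min (e/2) (e0 / (2 * D))"
    have "e1 > 0" using e e0 D by (simp add: e1_def)
    then obtain x where x: "x \<in> L" "norm x = 1" "g x < e1" "inner (B x) x > c - \<eta>" using above[OF _ \<eta>] by blast
    define z where "z = F x"
    have z: "z \<in> L" "norm z \<le> K" using FL[OF x(1)] Fbound[OF x(1)] x(2) by (auto simp: z_def)
    define y where "y = x + t *\<^sub>R z"
    have y: "y \<in> L" using x z csubspaceD[OF L] by (simp add: y_def)
    have "t * norm z \<le> t * K" using z t by (intro mult_left_mono) auto
    then have tz: "norm (t *\<^sub>R z) \<le> 1/2" using t by simp
    have ny: "norm y \<ge> 1/2" "norm y \<le> 2"
      using norm_triangle_ineq[of x "t *\<^sub>R z"] norm_diff_ineq[of x "t *\<^sub>R z"] tz x(2) by (auto simp: y_def)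
    have "g y \<le> g x + t * g z"
      using g x(1) z(1) csubspaceD(4)[OF L z(1), of t] t(1)
      unfolding seminorm_on_def y_def scaleR_scaleC by (metis abs_of_pos norm_of_real)
    also have "\<dots> \<le> g x + t * ((C + \<bar>c\<bar>) * g x)" using gF[OF x(1)] t(1) by (simp add: z_def)
    also have "\<dots> = D * g x" by (simp add: D_def distrib_right mult.assoc)
    also have "\<dots> < D * (e0 / (2 * D))" using x(3) D by (intro mult_strict_left_mono) (auto simp: e1_def)
    also have "\<dots> = e0 / 2" using D by simp
    finally have gy: "g y < e0 / 2" .
    define u where "u = inverse (norm y) *\<^sub>R y"
    have ny0: "norm y \<noteq> 0" and inv: "inverse (norm y) \<le> 2"
      using ny(1) le_imp_inverse_le[OF ny(1)] by (linarith, simp)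
    then have u: "u \<in> L" "norm u = 1" using y csubspaceD(6)[OF L] by (auto simp: u_def)
    have "g u = inverse (norm y) * g y"
      using g y unfolding seminorm_on_def u_def scaleR_scaleC by (simp add: norm_inverse)
    also have "\<dots> \<le> 2 * g y"
      using inv seminorm_nonneg[OF g L y] by (rule mult_right_mono)
    also have "\<dots> < e0" using gy by simp
    finally have "inner (B u) u \<le> c + \<eta>" using e0 u by blast
    then have "inner (F u) u \<le> \<eta>" 
      using u(2) by (simp add: F_def inner_diff_left dot_square_norm)
    moreover have "y = norm y *\<^sub>R u" using ny0 by (simp add: u_def)
    then have "inner (F y) y = (norm y)\<^sup>2 * inner (F u) u"
      using Fadd[OF csubspaceD(1)[OF L] u(1), of "norm y"] bounded_op_more(1)[OF b(1) L]
      by (metis F_def add_0 diff_self inner_scaleR_left inner_scaleR_right mult.assoc power2_eq_square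
          scaleR_zero_right)
    ultimately have "inner (F y) y \<le> (norm y)\<^sup>2 * \<eta>" by (simp add: mult_left_mono)
    also have "\<dots> \<le> 2\<^sup>2 * \<eta>" using ny \<eta> by (intro mult_right_mono power_mono) auto
    finally have up: "inner (F y) y \<le> 4 * \<eta>" by simp
    have "inner (F x) x > - \<eta>" using x(2,4) by (simp add: F_def inner_diff_left dot_square_norm)
    moreover have "inner (F y) y = inner (F x) x + 2 * t * (norm z)\<^sup>2 + t\<^sup>2 * inner (F z) z"
    proof -
      have "inner (F z) x = (norm z)\<^sup>2" using Fsym[OF z(1) x(1)] by (simp add: z_def dot_square_norm)
      moreover have "inner (F x) z = (norm z)\<^sup>2" by (simp add: z_def dot_square_norm)
      ultimately show ?thesis
        unfolding y_def Fadd[OF x(1) z(1)]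
        by (simp add: inner_add_left inner_add_right power2_eq_square distrib_left)
    qed
    moreover have "t\<^sup>2 * inner (F z) z \<ge> - (t * (norm z)\<^sup>2)"
    proof -
      have "\<bar>inner (F z) z\<bar> \<le> K * norm z * norm z"
        using Cauchy_Schwarz_ineq2[of "F z" z] mult_right_mono[OF Fbound[OF z(1)], of "norm z"] by simp
      then have "- inner (F z) z \<le> K * (norm z)\<^sup>2" by (simp add: power2_eq_square mult.assoc)
      then have "t\<^sup>2 * - inner (F z) z \<le> t\<^sup>2 * (K * (norm z)\<^sup>2)" by (intro mult_left_mono) auto
      also have "\<dots> = t * (1/2) * (norm z)\<^sup>2" unfolding t(2)[symmetric] by (simp add: power2_eq_square)
      also have "\<dots> \<le> t * (norm z)\<^sup>2" using t by simp
      finally show ?thesis by simp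
    qed
    ultimately have "t * (norm z)\<^sup>2 < 6 * \<eta>" using up \<eta> by linarith
    then have "(norm z)\<^sup>2 < (e/2)\<^sup>2" using t(1) by (simp add: \<eta>_def)
    then have "norm z < e/2" by (rule power2_less_imp_less) (use e in simp)
    then have "g x + resid B c x < e"
      using x(3) by (simp add: z_def F_def resid_def scaleR_scaleC e1_def)
    then show "\<exists>x\<in>L. norm x = 1 \<and> g x + resid B c x < e" using x by blast
  qed
  then show ?thesis using that c_t0 by blast
qed

text \<open>The real part \<open>P\<close> and the imaginary part \<open>Q\<close> of
  \<open>N\<close> are commuting self-adjoint operators. The self-adjoint case is applied to
  \<open>P\<close>, then to \<open>Q\<close> with the residual of \<open>P\<close> added to the
  seminorm; commutation keeps the enlarged seminorm stable, and the eigenvalue of \<open>N\<close>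
  is \<open>p + \<i> * q\<close>.\<close>

lemma normal_approx_eigenvalue:
  assumes L: "csubspace L" and N: "normal_pair L N N'" and g: "seminorm_on L g"
    and st: "stable_under L g N" "stable_under L g N'" and an: "approx_null L g"
  obtains c where "approx_null L (\<lambda>x. g x + resid N c x)"
proof -
  note a = normal_pairD(1)[OF N] and b = adj_pairD[OF normal_pairD(1)[OF N]]
  note swap = normal_pairD(2)[OF N]
  \<comment> \<open>The threshold in \<open>selfadjoint_approx_eigenvalue\<close> is harmless here:
    every unit vector has form at least \<open>- \<beta>\<close>.\<close>
  have selfadj: "\<exists>c::real. approx_null L (\<lambda>x. h x + resid B c x)"
    if B: "adj_pair L B B" and h: "seminorm_on L h" "stable_under L h B" "approx_null L h" for B h
  proof -
    obtain \<beta> where \<beta>: "\<beta> > 0" "\<And>x. x \<in> L \<Longrightarrow> norm (B x) \<le> \<beta> * norm x"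
      using bounded_op_bound[OF adj_pairD(1)[OF B]] by blast
    have "inner (B x) x \<ge> - \<beta>" if "x \<in> L" "norm x = 1" for x
      using Cauchy_Schwarz_ineq2[of "B x" x] \<beta>(2)[OF that(1)] that(2) by simp
    then have "\<exists>x\<in>L. norm x = 1 \<and> h x < e \<and> inner (B x) x \<ge> - \<beta>" if "e > 0" for e
      using h(3) that unfolding approx_null_def by blast
    from selfadjoint_approx_eigenvalue[OF L B h(1,2) this] show ?thesis by blast
  qed
  define P where "P x = (1/2) *\<^sub>C N x + (1/2) *\<^sub>C N' x" for x
  define Q where "Q x = (- \<i>/2) *\<^sub>C N x + (\<i>/2) *\<^sub>C N' x" for x
  have P: "adj_pair L P P"
    using adj_pair_add[OF L adj_pair_scaleC[OF L a, of "1/2"] adj_pair_scaleC[OF L adj_pair_sym[OF a], of "1/2"]]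
    unfolding P_def[abs_def] by (simp add: add.commute)
  have Q: "adj_pair L Q Q"
    using adj_pair_add[OF L adj_pair_scaleC[OF L a, of "- \<i>/2"] adj_pair_scaleC[OF L adj_pair_sym[OF a], of "\<i>/2"]]
    unfolding Q_def[abs_def] by (simp add: add.commute)
  have PQ: "P (Q x) = Q (P x)" if x: "x \<in> L" for x
  proof -
    have lin: "N (u *\<^sub>C N x + v *\<^sub>C N' x) = u *\<^sub>C N (N x) + v *\<^sub>C N (N' x)"
      "N' (u *\<^sub>C N x + v *\<^sub>C N' x) = u *\<^sub>C N (N' x) + v *\<^sub>C N' (N' x)" for u v
      using b(3,4) x bounded_opD[OF b(1)] bounded_opD[OF b(2)] csubspaceD(4)[OF L] swap by simp_all
    show ?thesis
      unfolding P_def Q_def lin by (simp add: scaleC_add_right scaleC_diff_right scaleC_scaleC)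
  qed
  have N_eq: "N x = P x + \<i> *\<^sub>C Q x" for x
    using scaleC_add_left[of "1/2" "1/2" "N x"]
    by (simp add: P_def Q_def scaleC_add_right scaleC_diff_right scaleC_scaleC)
  obtain p :: real where p: "approx_null L (\<lambda>x. g x + resid P p x)"
    using selfadj[OF P g _ an] stable_combination[OF st g L b(3,4), of "1/2" "1/2"]
    unfolding P_def[abs_def] by blast
  define h where "h x = g x + resid P p x" for x
  have h: "seminorm_on L h"
    unfolding h_def[abs_def] by (intro seminorm_add g seminorm_resid adj_pairD[OF P] L)
  have "stable_under L g Q"
    using stable_combination[OF st g L b(3,4), of "- \<i>/2" "\<i>/2"] unfolding Q_def[abs_def] .
  then have "stable_under L h Q"
    unfolding h_def[abs_def]
    using g PQ by (intro stable_add stable_resid seminorm_resid adj_pairD[OF P] adj_pairD[OF Q] L) auto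
  then obtain q :: real where q: "approx_null L (\<lambda>x. h x + resid Q q x)"
    using selfadj[OF Q h] p unfolding h_def[abs_def] by blast
  have "approx_null L (\<lambda>x. g x + resid N (p + \<i> * q) x)"
  proof (rule approx_null_mono[OF q, of _ 1])
    fix x
    have "N x - (p + \<i> * q) *\<^sub>C x = (P x - p *\<^sub>C x) + \<i> *\<^sub>C (Q x - q *\<^sub>C x)"
      by (simp add: N_eq scaleC_add_left scaleC_diff_right scaleC_scaleC)
    then have "resid N (p + \<i> * q) x \<le> resid P p x + resid Q q x"
      unfolding resid_def by (metis mult_1 norm_ii norm_scaleC norm_triangle_ineq)
    then show "g x + resid N (p + \<i> * q) x \<le> 1 * (h x + resid Q q x)" by (simp add: h_def)
  qed simp
  then show ?thesis using that by blast
qed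

text \<open>One operator is treated at a time, its residual being added to the seminorm. The next
  operator and its adjoint leave all earlier residuals stable, the adjoint by
  \<open>stable_resid_adjoint\<close>.\<close>

lemma joint_approx_eigenvalue:
  fixes N N' :: "nat \<Rightarrow> 'a::complex_hilbert_space \<Rightarrow> 'a"
  assumes L: "csubspace L" and fin: "finite J"
    and N: "\<And>j. j \<in> J \<Longrightarrow> normal_pair L (N j) (N' j)"
    and comm: "\<And>i j x. i \<in> J \<Longrightarrow> j \<in> J \<Longrightarrow> x \<in> L \<Longrightarrow> N i (N j x) = N j (N i x)"
    and g: "seminorm_on L g" and an: "approx_null L g"
    and st: "\<And>j. j \<in> J \<Longrightarrow> stable_under L g (N j)" "\<And>j. j \<in> J \<Longrightarrow> stable_under L g (N' j)"
  obtains l where "approx_null L (\<lambda>x. g x + (\<Sum>j\<in>J. resid (N j) (l j) x))"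
proof -
  note b = adj_pairD[OF normal_pairD(1)[OF N]]
  have "\<exists>l. approx_null L (\<lambda>x. g x + (\<Sum>j\<in>F. resid (N j) (l j) x))" if "F \<subseteq> J" for F
    using finite_subset[OF that fin] that
  proof (induction F rule: finite_induct)
    case empty
    then show ?case using an by simp
  next
    case (insert k F)
    then obtain l where l: "approx_null L (\<lambda>x. g x + (\<Sum>j\<in>F. resid (N j) (l j) x))" by auto
    define h where "h x = g x + (\<Sum>j\<in>F. resid (N j) (l j) x)" for x
    have sum: "seminorm_on L (\<lambda>x. \<Sum>j\<in>G. resid (N j) (l j) x)" if "G \<subseteq> F" for G
      using that insert.prems finite_subset[OF that insert.hyps(1)]
      by (intro seminorm_sum seminorm_resid b(1) L) auto
    have h: "seminorm_on L h" unfolding h_def[abs_def] by (intro seminorm_add g sum) simp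
    have stF: "stable_under L (\<lambda>x. \<Sum>j\<in>F. resid (N j) (l j) x) U" if U: "U = N k \<or> U = N' k" for U
    proof -
      have "stable_under L (\<lambda>x. \<Sum>j\<in>G. resid (N j) (l j) x) U" if "G \<subseteq> F" for G
        using finite_subset[OF that insert.hyps(1)] that
      proof (induction G rule: finite_induct)
        case empty
        then show ?case by (simp add: stable_zero)
      next
        case (insert i G)
        have i: "i \<in> J" and k: "k \<in> J" using insert.prems \<open>insert k F \<subseteq> J\<close> by auto
        have "stable_under L (resid (N i) (l i)) U"
          using U stable_resid[OF b(1)[OF i] b(1)[OF k] L] comm[OF i k]
            stable_resid_adjoint[OF L N[OF i] normal_pairD(1)[OF N[OF k]]] by blast
        then have "stable_under L (\<lambda>x. resid (N i) (l i) x + (\<Sum>j\<in>G. resid (N j) (l j) x)) U"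
          using insert by (intro stable_add seminorm_resid b(1) L i sum) auto
        then show ?case using insert.hyps by simp
      qed
      then show ?thesis by blast
    qed
    have k: "k \<in> J" using insert.prems by simp
    obtain c where c: "approx_null L (\<lambda>x. h x + resid (N k) c x)"
    proof (rule normal_approx_eigenvalue[OF L N[OF k] h])
      show "stable_under L h (N k)" unfolding h_def[abs_def]
        using st k stF by (intro stable_add g L sum) auto
      show "stable_under L h (N' k)" unfolding h_def[abs_def]
        using st k stF by (intro stable_add g L sum) auto
      show "approx_null L h" using l by (simp add: h_def[abs_def])
    qed
    have "(\<Sum>j\<in>insert k F. resid (N j) ((l(k := c)) j) x) = resid (N k) c x + (\<Sum>j\<in>F. resid (N j) (l j) x)" for x
    proof -
      have "(\<Sum>j\<in>F. resid (N j) ((l(k := c)) j) x) = (\<Sum>j\<in>F. resid (N j) (l j) x)"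
        using insert.hyps by (intro sum.cong) auto
      then show ?thesis using insert.hyps by simp
    qed
    then have "approx_null L (\<lambda>x. g x + (\<Sum>j\<in>insert k F. resid (N j) ((l(k := c)) j) x))"
      using c by (simp add: h_def add_ac)
    then show ?case by blast
  qed
  then show ?thesis using that by blast
qed

text \<open>The positive operator \<open>B = T'T\<close> has form
  \<open>(norm (T x))\<^sup>2\<close>, which is positive somewhere, and so it has an approximate
  eigenvalue \<open>c > 0\<close>. Refining its approximate eigenvectors to ones of
  \<open>T\<close>, the eigenvalue 0 is excluded: a small \<open>T x\<close> would make
  \<open>B x\<close> small as well.\<close>

lemma nonzero_approx_eigenvalue:
  assumes L: "csubspace L" and T: "normal_pair L T T'" and x0: "x0 \<in> L" "T x0 \<noteq> 0"
  obtains c where "c \<noteq> 0" "approx_null L (resid T c)"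
proof -
  note a = normal_pairD(1)[OF T] and b = adj_pairD[OF normal_pairD(1)[OF T]]
  define B where "B x = T' (T x)" for x
  have B: "adj_pair L B B"
    using adj_pair_compose[OF adj_pair_sym[OF a] a] by (simp add: B_def[abs_def])
  have n0: "norm x0 > 0" using x0 bounded_op_more(1)[OF b(1) L] by auto
  define u where "u = inverse (norm x0) *\<^sub>R x0"
  have u: "u \<in> L" "norm u = 1" using n0 x0 csubspaceD(6)[OF L] by (auto simp: u_def)
  have "T u \<noteq> 0" using bounded_op_more(4)[OF b(1) L x0(1)] x0(2) n0 by (simp add: u_def)
  define t0 where "t0 = (norm (T u))\<^sup>2"
  have t0: "t0 > 0" using \<open>T u \<noteq> 0\<close> by (simp add: t0_def)
  have "inner (B u) u \<ge> t0"
    using b(3,6) u(1) by (simp add: B_def t0_def inner_eq_Re_cinner cinner_self)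
  then have ex: "\<exists>x\<in>L. norm x = 1 \<and> 0 < e \<and> inner (B x) x \<ge> t0" if "e > 0" for e :: real
    using u that by blast
  \<comment> \<open>The zero seminorm imposes no restriction, so one vector with form at least
    \<open>t0\<close> serves for every \<open>e\<close>.\<close>
  obtain c :: real where c: "c \<ge> t0" "approx_null L (\<lambda>x. 0 + resid B c x)"
    using selfadjoint_approx_eigenvalue[OF L B seminorm_zero stable_zero ex] by blast
  have an: "approx_null L (resid B c)" using c(2) by simp
  have "B (T x) = T (B x)" "B (T' x) = T' (B x)" if "x \<in> L" for x
    using that b(3,4) normal_pairD(2)[OF T] by (simp_all add: B_def)
  then have st: "stable_under L (resid B c) T" "stable_under L (resid B c) T'"
    by (auto intro!: stable_resid adj_pairD[OF B] b(1,2) L)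
  obtain d where d: "approx_null L (\<lambda>x. resid B c x + resid T d x)"
    using normal_approx_eigenvalue[OF L T seminorm_resid[OF adj_pairD(1)[OF B] L] st an] by blast
  obtain C where C: "C > 0" "\<And>x. x \<in> L \<Longrightarrow> norm (T' x) \<le> C * norm x" using bounded_op_bound[OF b(2)] by blast
  have "d \<noteq> 0"
  proof
    assume d0: "d = 0"
    have "c \<le> (1 + C) * (resid B c x + resid T d x)" if x: "x \<in> L" "norm x = 1" for x
    proof -
      have "c = norm (complex_of_real c *\<^sub>C x)" using x c t0 by (simp add: norm_scaleC)
      also have "\<dots> \<le> norm (B x - complex_of_real c *\<^sub>C x) + norm (B x)"
        using norm_triangle_ineq4[of "B x" "B x - complex_of_real c *\<^sub>C x"] by simp
      also have "norm (B x) \<le> C * norm (T x)" using C(2)[OF b(3)[OF x(1)]] by (simp add: B_def)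
      finally have "c \<le> resid B c x + C * resid T d x" by (simp add: resid_def d0)
      moreover have "0 \<le> C * resid B c x" "0 \<le> resid T d x" using C by (auto simp: resid_def)
      ultimately show ?thesis by (simp add: distrib_left distrib_right)
    qed
    from approx_null_imp_zero[OF d this] show False using C c t0 by simp
  qed
  moreover have "approx_null L (resid T d)"
    by (rule approx_null_mono[OF d, of _ 1]) (auto simp: resid_def)
  ultimately show ?thesis using that by blast
qed

section \<open>Taylor spectrum and unitary tuples\<close>

text \<open>\<open>x\<close> is the sum of \<open>\<plusminus>(1/4) ^ k *\<^sub>R u k\<close>.
  Nothing relates different \<open>u k\<close>, so each sign is chosen after the earlier partial
  sum, to avoid cancellation in its product with \<open>u k\<close>: that product then has modulus
  at least \<open>(1/4) ^ k\<close>. All later terms together have norm at most a third of this,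
  leaving more than half.\<close>

lemma gliding_hump:
  fixes u :: "nat \<Rightarrow> 'a::complex_hilbert_space"
  assumes L: "closed_csubspace L" and u: "\<And>k. u k \<in> L" "\<And>k. norm (u k) = 1"
  shows "\<exists>x\<in>L. \<forall>k. \<bar>inner x (u k)\<bar> \<ge> (1/4) ^ k / 2"
proof -
  have sub: "csubspace L" and cl: "closed L" using L by (auto simp: closed_csubspace_def)
  define s where "s = rec_nat 0 (\<lambda>k y. y + ((if inner y (u k) \<ge> 0 then 1 else -1) * (1/4) ^ k) *\<^sub>R u k)"
  have s0: "s 0 = 0" and sS: "s (Suc k) = s k + ((if inner (s k) (u k) \<ge> 0 then 1 else -1) * (1/4) ^ k) *\<^sub>R u k" for k
    by (simp_all add: s_def)
  have sL: "s k \<in> L" for k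
    by (induction k) (auto simp: s0 sS intro!: csubspaceD[OF sub] u)
  have big: "\<bar>inner (s (Suc k)) (u k)\<bar> \<ge> (1/4) ^ k" for k
  proof -
    have "inner (u k) (u k) = 1" using u(2)[of k] by (simp add: dot_square_norm)
    then show ?thesis unfolding sS by (auto simp: inner_add_left)
  qed
  have step: "norm (s (Suc k) - s k) = (1/4) ^ k" for k
    unfolding sS using u(2)[of k] by (simp add: abs_mult)
  have tail: "norm (s (k + m) - s k) \<le> 4/3 * (1/4) ^ k * (1 - (1/4) ^ m)" for k m
  proof (induction m)
    case (Suc m)
    have "norm (s (k + Suc m) - s k) \<le> norm (s (Suc (k + m)) - s (k + m)) + norm (s (k + m) - s k)"
      using norm_triangle_ineq[of "s (Suc (k + m)) - s (k + m)" "s (k + m) - s k"] by simp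
    also have "\<dots> \<le> (1/4) ^ (k + m) + 4/3 * (1/4) ^ k * (1 - (1/4) ^ m)" using step Suc by simp
    also have "\<dots> = 4/3 * (1/4) ^ k * (1 - (1/4) ^ Suc m)" by (simp add: power_add field_simps)
    finally show ?case .
  qed simp
  have tail': "norm (s m - s k) \<le> 4/3 * (1/4) ^ k" if "m \<ge> k" for k m
  proof -
    have "norm (s m - s k) \<le> 4/3 * (1/4) ^ k * (1 - (1/4) ^ (m - k))" using tail[of k "m - k"] that by simp
    also have "\<dots> \<le> 4/3 * (1/4) ^ k * 1" by (intro mult_left_mono) auto
    finally show ?thesis by simp
  qed
  have "Cauchy s"
  proof (rule metric_CauchyI)
    fix e :: real assume "e > 0"
    then obtain k where k: "(1/4) ^ k < e * 3 / 8" using real_arch_pow_inv[of "e * 3 / 8" "1/4"] by auto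
    have "dist (s i) (s j) < e" if "i \<ge> k" "j \<ge> k" for i j
    proof -
      have "dist (s i) (s j) \<le> norm (s i - s k) + norm (s j - s k)"
        using dist_triangle2[of "s i" "s j" "s k"] by (simp add: dist_norm)
      also have "\<dots> \<le> 4/3 * (1/4) ^ k + 4/3 * (1/4) ^ k" using tail' that by (intro add_mono) auto
      finally show ?thesis using k by simp
    qed
    then show "\<exists>M. \<forall>m\<ge>M. \<forall>n\<ge>M. dist (s m) (s n) < e" by blast
  qed
  then obtain x where x: "s \<longlonglongrightarrow> x" using Cauchy_convergent convergent_def by blast
  show ?thesis
  proof (intro bexI allI)
    show "x \<in> L" using closed_sequentially[OF cl] sL x by blast
    show "\<bar>inner x (u k)\<bar> \<ge> (1/4) ^ k / 2" for k
    proof -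
      have "(\<lambda>m. norm (s m - s (Suc k))) \<longlonglongrightarrow> norm (x - s (Suc k))" by (intro tendsto_intros x)
      then have "norm (x - s (Suc k)) \<le> 4/3 * (1/4) ^ Suc k"
        by (rule LIMSEQ_le_const2) (use tail' in blast)
      moreover have "\<bar>inner (x - s (Suc k)) (u k)\<bar> \<le> norm (x - s (Suc k))"
        using Cauchy_Schwarz_ineq2[of "x - s (Suc k)" "u k"] u(2) by simp
      moreover have "inner x (u k) = inner (s (Suc k)) (u k) + inner (x - s (Suc k)) (u k)"
        by (simp add: inner_diff_left)
      moreover have "4/3 * (1/4) ^ Suc k = (1/3) * (1/4 :: real) ^ k" "(1/4 :: real) ^ k > 0" by simp_all
      ultimately show ?thesis using big[of k] by linarith
    qed
  qed
qed

text \<open>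
  Exactness of the Koszul complex in the top degree makes every vector a sum of vectors
  \<open>(T\<^sub>j - l\<^sub>j) y\<^sub>j\<close>; a vector produced by \<open>gliding_hump\<close> from approximate eigenvectors
  of the adjoints is not of this form.
\<close>

lemma approx_eigenvalue_in_taylor_spectrum:
  assumes L: "closed_csubspace L"
    and T: "\<And>i. i \<in> {1..n} \<Longrightarrow> normal_pair L (T i) (T' i)"
    and an: "approx_null L (\<lambda>x. \<Sum>i\<in>{1..n}. resid (T i) (l i) x)"
  shows "restrict l {1..n} \<in> taylor_spectrum n L T"
proof (rule ccontr)
  have sub: "csubspace L" using L by (simp add: closed_csubspace_def)
  note a = adj_pairD[OF normal_pairD(1)[OF T]]
  let ?I = "{1..n}"
  define W where "W = (\<lambda>i x. T i x - restrict l ?I i *\<^sub>C x)"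
  define d where "d = koszul_map n W"
  assume "restrict l ?I \<notin> taylor_spectrum n L T"
  then have exact: "{\<xi> \<in> koszul_space n L. d \<xi> = (\<lambda>J\<in>Pow ?I. 0)} = d ` koszul_space n L"
    by (auto simp: taylor_spectrum_def Let_def d_def W_def)
  have W0: "W i 0 = 0" if "i \<in> ?I" for i
    using bounded_op_more(1)[OF a(1)[OF that] sub] by (simp add: W_def)
  \<comment> \<open>\<open>c\<close> gathers the signs of the Koszul map; only their bound by 1 is
    used afterwards.\<close>
  have onto: "\<exists>c y. (\<forall>j\<in>?I. y j \<in> L) \<and> (\<forall>j. \<bar>c j\<bar> \<le> (1::real)) \<and> x = (\<Sum>j\<in>?I. c j *\<^sub>R W j (y j))"
    if x: "x \<in> L" for x
  proof -
    \<comment> \<open>A form of top degree: raising its degree would need an index outside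
      \<open>?I\<close>, so it lies in the kernel, and exactness provides a preimage.\<close>
    define \<xi> where "\<xi> = (\<lambda>J\<in>Pow ?I. if J = ?I then x else 0)"
    have "\<xi> \<in> koszul_space n L"
      using x csubspaceD(1)[OF sub] by (auto simp: koszul_space_def \<xi>_def)
    moreover have "d \<xi> = (\<lambda>J\<in>Pow ?I. 0)"
      unfolding d_def koszul_map_def
    proof (rule restrict_ext, rule sum.neutral, rule ballI)
      fix J j assume J: "J \<in> Pow ?I" "j \<in> J"
      then have "J - {j} \<noteq> ?I" "J - {j} \<in> Pow ?I" by auto
      then have "\<xi> (J - {j}) = 0" by (simp add: \<xi>_def)
      then show "(-1) ^ card {i \<in> J. i < j} *\<^sub>R W j (\<xi> (J - {j})) = 0" using W0 J by auto
    qed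
    ultimately have "\<xi> \<in> d ` koszul_space n L" unfolding exact[symmetric] by simp
    then obtain \<eta> where \<eta>: "\<eta> \<in> koszul_space n L" "d \<eta> = \<xi>" by (auto simp only: image_iff)
    have "x = \<xi> ?I" by (simp add: \<xi>_def)
    also have "\<dots> = (\<Sum>j\<in>?I. (-1) ^ card {i \<in> ?I. i < j} *\<^sub>R W j (\<eta> (?I - {j})))"
      unfolding \<eta>(2)[symmetric] d_def koszul_map_def by simp
    finally show ?thesis
      using \<eta>(1) unfolding koszul_space_def
      by (intro exI[of _ "\<lambda>j. (-1) ^ card {i \<in> ?I. i < j}"] exI[of _ "\<lambda>j. \<eta> (?I - {j})"])
        (auto simp: power_abs)
  qed
  \<comment> \<open>The rate \<open>(1/8) ^ k\<close> has to beat the lower bound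
    \<open>(1/4) ^ k / 2\<close> of \<open>gliding_hump\<close>: comparing the two leaves
    \<open>2 ^ k / 2 \<le> Y\<close> for every \<open>k\<close>, with \<open>Y\<close>
    fixed.\<close>
  have "\<exists>x\<in>L. norm x = 1 \<and> (\<Sum>i\<in>?I. resid (T i) (l i) x) < (1/8) ^ k" for k :: nat
    using an unfolding approx_null_def by simp
  then obtain u where u: "\<And>k. u k \<in> L" "\<And>k. norm (u k) = 1"
      "\<And>k. (\<Sum>i\<in>?I. resid (T i) (l i) (u k)) < (1/8) ^ k" by metis
  obtain x where x: "x \<in> L" "\<forall>k. \<bar>inner x (u k)\<bar> \<ge> (1/4) ^ k / 2"
    using gliding_hump[of L u, OF L u(1,2)] by (elim bexE)
  obtain c y where cy: "\<forall>j\<in>?I. y j \<in> L" "\<forall>j. \<bar>c j\<bar> \<le> (1::real)" "x = (\<Sum>j\<in>?I. c j *\<^sub>R W j (y j))"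
    using onto[OF x(1)] by (elim exE conjE) (rule that)
  have y: "\<And>j. j \<in> ?I \<Longrightarrow> y j \<in> L" "\<And>j. \<bar>c j\<bar> \<le> 1" using cy by auto
  define Y where "Y = (\<Sum>j\<in>?I. norm (y j))"
  have bound: "\<bar>inner x (u k)\<bar> \<le> Y * (1/8) ^ k" for k
  proof -
    have each: "\<bar>inner (c j *\<^sub>R W j (y j)) (u k)\<bar> \<le> norm (y j) * (1/8) ^ k" if j: "j \<in> ?I" for j
    proof -
      have "cinner (W j (y j)) (u k) = cinner (y j) (T' j (u k) - cnj (l j) *\<^sub>C u k)"
        using a(5)[OF j y(1)[OF j] u(1)] j by (simp add: W_def cinner_simps)
      then have "\<bar>inner (W j (y j)) (u k)\<bar> \<le> cmod (cinner (y j) (T' j (u k) - cnj (l j) *\<^sub>C u k))"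
        by (metis inner_eq_Re_cinner abs_Re_le_cmod)
      also have "\<dots> \<le> norm (y j) * resid (T' j) (cnj (l j)) (u k)" unfolding resid_def by (rule cinner_norm_le)
      also have "\<dots> = norm (y j) * resid (T j) (l j) (u k)" using resid_adjoint[OF sub T[OF j] u(1)] by simp
      also have "resid (T j) (l j) (u k) \<le> (\<Sum>i\<in>?I. resid (T i) (l i) (u k))"
        using j by (intro member_le_sum) (auto simp: resid_def)
      also have "\<dots> \<le> (1/8) ^ k" using u(3) less_imp_le by blast
      finally have "\<bar>inner (W j (y j)) (u k)\<bar> \<le> norm (y j) * (1/8) ^ k" by (simp add: mult_left_mono)
      moreover have "\<bar>inner (c j *\<^sub>R W j (y j)) (u k)\<bar> \<le> \<bar>inner (W j (y j)) (u k)\<bar>"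
        using y(2)[of j] by (simp add: abs_mult mult_left_le_one_le)
      ultimately show ?thesis by simp
    qed
    have "\<bar>inner x (u k)\<bar> \<le> (\<Sum>j\<in>?I. \<bar>inner (c j *\<^sub>R W j (y j)) (u k)\<bar>)"
      unfolding cy(3) inner_sum_left by (rule sum_abs)
    also have "\<dots> \<le> (\<Sum>j\<in>?I. norm (y j) * (1/8) ^ k)" by (rule sum_mono) (rule each)
    also have "\<dots> = Y * (1/8) ^ k" by (simp add: Y_def sum_distrib_right)
    finally show ?thesis .
  qed
  obtain k where k: "2 * Y < 2 ^ k" using real_arch_pow[of 2 "2 * Y"] by auto
  have "(1/4) ^ k / 2 \<le> Y * (1/8) ^ k" using spec[OF x(2), of k] bound[of k] by linarith
  then have "8 ^ k * ((1/4) ^ k / 2) \<le> 8 ^ k * (Y * (1/8) ^ k)" by (intro mult_left_mono) auto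
  moreover have "8 ^ k * (1/8 :: real) ^ k = 1" "8 ^ k * (1/4 :: real) ^ k = 2 ^ k"
    by (simp_all flip: power_mult_distrib)
  ultimately have "2 ^ k / 2 \<le> Y" by (simp add: mult.left_commute)
  then show False using k by simp
qed

text \<open>A product of numbers in the closed disc has modulus 1 only if each factor does. Then
  conjugation inverts every \<open>z j\<close>, and the conjugate product over \<open>J\<close>,
  multiplied by the full product, is the product over the complement of \<open>J\<close>.\<close>

lemma bGamma_set_relation:
  assumes s: "s \<in> bGamma_set n" and i: "i \<in> {1..n-1}"
  shows "s i = cnj (s (n - i)) * s n"
proof -
  let ?I = "{1..n}"
  obtain z where z: "z \<in> ?I \<rightarrow>\<^sub>E cball 0 1" "s = (\<lambda>k\<in>?I. elem_sym n k z)"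
    using s by (auto simp: bGamma_set_def Gamma_set_def)
  have zle: "cmod (z j) \<le> 1" if "j \<in> ?I" for j using z(1) that by auto
  have "{J. J \<subseteq> ?I \<and> card J = n} = {?I}"
    using card_subset_eq[of ?I] by auto
  then have "elem_sym n n z = (\<Prod>j\<in>?I. z j)" by (simp add: elem_sym_def)
  moreover have "n \<in> ?I" using i by auto
  ultimately have sn: "s n = (\<Prod>j\<in>?I. z j)" by (simp add: z(2) del: atLeastAtMost_iff)
  have z1: "z j * cnj (z j) = 1" if j: "j \<in> ?I" for j
  proof -
    have "1 = (\<Prod>j\<in>?I. cmod (z j))" using s sn by (simp add: bGamma_set_def prod_norm)
    also have "\<dots> = cmod (z j) * (\<Prod>j\<in>?I - {j}. cmod (z j))" using j by (intro prod.remove) auto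
    also have "\<dots> \<le> cmod (z j) * 1" using zle by (intro mult_left_mono prod_le_1) auto
    finally have "cmod (z j) = 1" using zle[OF j] by simp
    then show ?thesis using complex_norm_square[of "z j"] by simp
  qed
  have "elem_sym n i z = (\<Sum>J | J \<subseteq> ?I \<and> card J = n - i. \<Prod>j\<in>?I - J. z j)"
    unfolding elem_sym_def
  proof (rule sum.reindex_bij_witness[of _ "\<lambda>J. ?I - J" "\<lambda>J. ?I - J"])
    fix J assume "J \<in> {J. J \<subseteq> ?I \<and> card J = n - i}"
    then show "?I - J \<in> {J. J \<subseteq> ?I \<and> card J = i}"
      using i finite_subset[of J ?I] by (auto simp: card_Diff_subset)
  next
    fix J assume "J \<in> {J. J \<subseteq> ?I \<and> card J = i}"
    then show "?I - J \<in> {J. J \<subseteq> ?I \<and> card J = n - i}"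
      using i finite_subset[of J ?I] by (auto simp: card_Diff_subset)
  qed (auto simp: double_diff)
  also have "\<dots> = (\<Sum>J | J \<subseteq> ?I \<and> card J = n - i. cnj (\<Prod>j\<in>J. z j) * (\<Prod>j\<in>?I. z j))"
  proof (rule sum.cong)
    fix J assume "J \<in> {J. J \<subseteq> ?I \<and> card J = n - i}"
    then have J: "J \<subseteq> ?I" by simp
    have "cnj (\<Prod>j\<in>J. z j) * (\<Prod>j\<in>?I. z j) = cnj (\<Prod>j\<in>J. z j) * ((\<Prod>j\<in>?I - J. z j) * (\<Prod>j\<in>J. z j))"
      using J by (simp add: prod.subset_diff)
    also have "\<dots> = (\<Prod>j\<in>J. z j * cnj (z j)) * (\<Prod>j\<in>?I - J. z j)"
      by (simp add: prod.distrib)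
    also have "(\<Prod>j\<in>J. z j * cnj (z j)) = 1" using z1 J by (intro prod.neutral) auto
    finally show "(\<Prod>j\<in>?I - J. z j) = cnj (\<Prod>j\<in>J. z j) * (\<Prod>j\<in>?I. z j)" by simp
  qed simp
  also have "\<dots> = cnj (elem_sym n (n - i) z) * (\<Prod>j\<in>?I. z j)"
    by (simp add: elem_sym_def sum_distrib_right)
  moreover have "i \<in> ?I" "n - i \<in> ?I" using i by auto
  ultimately show ?thesis using z(2) sn by simp
qed

section \<open>Operator identities forced by the spectrum of a \<open>Gamma_unitary\<close>
  tuple\<close>

lemma approx_eigenvalue_unique:
  assumes "approx_null L g" "\<And>x. x \<in> L \<Longrightarrow> norm x = 1 \<Longrightarrow> resid T a x + resid T b x \<le> C * g x" "C > 0"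
  shows "a = b"
proof -
  have "cmod (a - b) \<le> 0"
  proof (rule approx_null_imp_zero[OF assms(1) _ assms(3)])
    fix x assume x: "x \<in> L" "norm x = 1"
    have "cmod (a - b) = norm ((T x - b *\<^sub>C x) - (T x - a *\<^sub>C x))"
      using x(2) by (simp add: norm_scaleC flip: scaleC_diff_left)
    also have "\<dots> \<le> resid T b x + resid T a x" unfolding resid_def by (rule norm_triangle_ineq4)
    finally show "cmod (a - b) \<le> C * g x" using assms(2)[OF x] by simp
  qed
  then show ?thesis by simp
qed

text \<open>Approximate eigenvalues multiply: the error is
  \<open>A (T x - c *\<^sub>C x) + c *\<^sub>C (A x - a *\<^sub>C x)\<close>.\<close>

lemma resid_compose:
  assumes A: "bounded_op L L A" and L: "csubspace L" and B: "\<And>x. x \<in> L \<Longrightarrow> norm (A x) \<le> B * norm x"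
    and x: "x \<in> L" "T x \<in> L"
  shows "norm (A (T x) - (a * c) *\<^sub>C x) \<le> B * resid T c x + cmod c * resid A a x"
proof -
  have "A (T x) - (a * c) *\<^sub>C x = A (T x - c *\<^sub>C x) + c *\<^sub>C (A x - a *\<^sub>C x)"
    using bounded_op_more(2)[OF A L x(2)] bounded_opD(3)[OF A] csubspaceD(4)[OF L] x
    by (simp add: scaleC_diff_right scaleC_scaleC mult.commute)
  also have "norm \<dots> \<le> norm (A (T x - c *\<^sub>C x)) + cmod c * norm (A x - a *\<^sub>C x)"
    by (metis norm_scaleC norm_triangle_ineq)
  also have "\<dots> \<le> B * norm (T x - c *\<^sub>C x) + cmod c * norm (A x - a *\<^sub>C x)"
    using B csubspaceD(3,4)[OF L] x by simp
  finally show ?thesis by (simp add: resid_def)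
qed

text \<open>The passage from operators to points of the spectrum: an approximate eigenspace stable
  under the tuple and its adjoints contains joint approximate eigenvectors, and their eigenvalues
  are a spectral point. Keeping \<open>g\<close> in the conclusion allows these eigenvalues to be
  compared with ones found before.\<close>

lemma Gamma_unitary_joint_eigenvalue:
  assumes L: "closed_csubspace L" and U: "Gamma_unitary n L U Q"
    and g: "seminorm_on L g" and an: "approx_null L g"
    and st: "\<And>j. j \<in> {1..n} \<Longrightarrow> stable_under L g ((U(n := Q)) j)"
      "\<And>j. j \<in> {1..n} \<Longrightarrow> stable_under L g (hadjoint L ((U(n := Q)) j))"
  obtains l where "l \<in> bGamma_set n"
    "approx_null L (\<lambda>x. g x + (\<Sum>j\<in>{1..n}. resid ((U(n := Q)) j) (l j) x))"
proof -
  have sub: "csubspace L" using L by (simp add: closed_csubspace_def)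
  let ?N = "U(n := Q)" and ?I = "{1..n}"
  have N: "normal_pair L (?N j) (hadjoint L (?N j))" if "j \<in> ?I" for j
    using U that unfolding Gamma_unitary_def by (intro normal_op_pair[OF L]) blast
  have comm: "?N i (?N j x) = ?N j (?N i x)" if "i \<in> ?I" "j \<in> ?I" "x \<in> L" for i j x
    using U that unfolding Gamma_unitary_def commuting_tuple_def by blast
  obtain l where l: "approx_null L (\<lambda>x. g x + (\<Sum>j\<in>?I. resid (?N j) (l j) x))"
    by (rule joint_approx_eigenvalue[OF sub _ N comm g an st])
      (assumption | rule finite_atLeastAtMost)+
  have "approx_null L (\<lambda>x. \<Sum>j\<in>?I. resid (?N j) (l j) x)"
    by (rule approx_null_mono[OF l, of _ 1]) (use seminorm_nonneg[OF g sub] in auto)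
  then have "restrict l ?I \<in> taylor_spectrum n L ?N"
    by (intro approx_eigenvalue_in_taylor_spectrum[where T = ?N, OF L N])
  then have "restrict l ?I \<in> bGamma_set n" using U unfolding Gamma_unitary_def by blast
  moreover have "(\<Sum>j\<in>?I. resid (?N j) (restrict l ?I j) x) = (\<Sum>j\<in>?I. resid (?N j) (l j) x)" for x
    by (intro sum.cong) auto
  ultimately show ?thesis using l by (intro that[of "restrict l ?I"]) simp_all
qed

text \<open>If \<open>T = I - Q'Q\<close> were nonzero, some vectors would be approximate
  eigenvectors of \<open>T\<close> for a nonzero \<open>\<tau>\<close> and of \<open>Q\<close> for
  some \<open>q\<close>. The spectrum forces \<open>q\<close> to be unimodular, and then
  \<open>T\<close> acts on these vectors nearly as \<open>1 - cnj q * q = 0\<close>.\<close>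

lemma Gamma_unitary_last_unitary:
  assumes L: "closed_csubspace L" and U: "Gamma_unitary n L U Q" and n: "n \<ge> 1" and x0: "x0 \<in> L"
  shows "hadjoint L Q (Q x0) = x0"
proof (rule ccontr)
  assume ne: "hadjoint L Q (Q x0) \<noteq> x0"
  have sub: "csubspace L" using L by (simp add: closed_csubspace_def)
  let ?N = "U(n := Q)" and ?I = "{1..n}"
  have N: "normal_pair L (?N j) (hadjoint L (?N j))" if "j \<in> ?I" for j
    using U that unfolding Gamma_unitary_def by (intro normal_op_pair[OF L]) blast
  have comm: "?N i (?N j x) = ?N j (?N i x)" if "i \<in> ?I" "j \<in> ?I" "x \<in> L" for i j x
    using U that unfolding Gamma_unitary_def commuting_tuple_def by blast
  define Q' where "Q' = hadjoint L Q"
  have Q: "normal_pair L Q Q'" using N[of n] n by (simp add: Q'_def)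
  note a = normal_pairD(1)[OF Q] and b = adj_pairD[OF normal_pairD(1)[OF Q]]
  define T where "T x = x - Q' (Q x)" for x
  have T: "normal_pair L T T"
    using adj_pair_diff[OF sub adj_pair_id adj_pair_compose[OF adj_pair_sym[OF a] a]]
    unfolding normal_pair_def T_def[abs_def] by simp
  obtain \<tau> where \<tau>: "\<tau> \<noteq> 0" "approx_null L (resid T \<tau>)"
    using nonzero_approx_eigenvalue[OF sub T x0] ne unfolding T_def Q'_def by auto
  note Tb = adj_pairD(1)[OF normal_pairD(1)[OF T]]
  have TQ: "T (Q x) = Q (T x)" if "x \<in> L" for x
    using that normal_pairD(2)[OF Q] bounded_op_more(2)[OF b(1) sub] b(3,4) by (simp add: T_def)
  obtain q where q: "approx_null L (\<lambda>x. resid T \<tau> x + resid Q q x)"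
    using normal_approx_eigenvalue[OF sub Q seminorm_resid[OF Tb sub] stable_resid[OF Tb b(1) sub TQ]
        stable_resid_adjoint[OF sub T a TQ] \<tau>(2)] by blast
  \<comment> \<open>The residual of \<open>T\<close> is dropped here: stability under the whole
    tuple would require \<open>Q'\<close> to commute with every \<open>?N j\<close>. The residual of
    \<open>Q\<close> alone is stable, and it suffices for locating \<open>q\<close>.\<close>
  have qn: "approx_null L (resid Q q)"
    by (rule approx_null_mono[OF q, of _ 1]) (auto simp: resid_def)
  have st: "stable_under L (resid Q q) (?N j)" "stable_under L (resid Q q) (hadjoint L (?N j))" if j: "j \<in> ?I" for j
    using stable_resid[OF b(1) adj_pairD(1)[OF normal_pairD(1)[OF N[OF j]]] sub]
      stable_resid_adjoint[OF sub Q normal_pairD(1)[OF N[OF j]]] comm[of n j] j n by auto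
  obtain l where l: "l \<in> bGamma_set n" "approx_null L (\<lambda>x. resid Q q x + (\<Sum>j\<in>?I. resid (?N j) (l j) x))"
    using Gamma_unitary_joint_eigenvalue[OF L U seminorm_resid[OF b(1) sub] qn st] by blast
  have "q = l n"
  proof (rule approx_eigenvalue_unique[OF l(2), of Q _ _ 1])
    fix x
    have "resid (?N n) (l n) x \<le> (\<Sum>j\<in>?I. resid (?N j) (l j) x)"
      using n by (intro member_le_sum) (auto simp: resid_def)
    then show "resid Q q x + resid Q (l n) x \<le> 1 * (resid Q q x + (\<Sum>j\<in>?I. resid (?N j) (l j) x))" by simp
  qed simp
  then have q1: "cmod q = 1" using l(1) by (simp add: bGamma_set_def)
  then have qq: "cnj q * q = 1" using complex_norm_square[of q] by (simp add: mult.commute)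
  obtain B where B: "B > 0" "\<And>x. x \<in> L \<Longrightarrow> norm (Q' x) \<le> B * norm x" using bounded_op_bound[OF b(2)] by blast
  \<comment> \<open>Back to the vectors of \<open>q\<close>, where the residuals of \<open>T\<close>
    and of \<open>Q\<close> are small simultaneously.\<close>
  have "cmod \<tau> \<le> 0"
  proof (rule approx_null_imp_zero[OF q])
    fix x assume x: "x \<in> L" "norm x = 1"
    have "norm (Q' (Q x) - (cnj q * q) *\<^sub>C x) \<le> B * resid Q q x + cmod q * resid Q' (cnj q) x"
      by (rule resid_compose[where A=Q' and T=Q, OF b(2) sub B(2) x(1) b(3)[OF x(1)]])
    then have "norm (T x) \<le> (B + 1) * resid Q q x"
      using resid_adjoint[OF sub Q x(1), of q]
      by (simp add: T_def qq q1 norm_minus_commute distrib_right)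
    moreover have "cmod \<tau> \<le> norm (T x) + resid T \<tau> x"
      using norm_triangle_ineq4[of "T x" "T x - \<tau> *\<^sub>C x"] x(2) by (simp add: resid_def norm_scaleC)
    moreover have "0 \<le> B * resid T \<tau> x" using B by (simp add: resid_def)
    ultimately show "cmod \<tau> \<le> (B + 1) * (resid T \<tau> x + resid Q q x)" by (simp add: distrib_left distrib_right)
  qed (use B in simp)
  then show False using \<tau> by simp
qed

text \<open>With \<open>M = U (n - i)\<close> and \<open>N = U i\<close>, suppose that
  \<open>T = N - M'Q\<close> is nonzero. Approximate eigenvalues \<open>\<tau>\<close>,
  \<open>q\<close>, \<open>\<mu>\<close> of \<open>T\<close>, \<open>Q\<close>, \<open>M\<close> at
  common vectors force the eigenvalue \<open>\<tau> + cnj \<mu> * q\<close> on \<open>N\<close>,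
  whereas a point of \<open>bGamma_set n\<close> allows only \<open>cnj \<mu> * q\<close>.\<close>

lemma Gamma_unitary_relation:
  assumes L: "closed_csubspace L" and U: "Gamma_unitary n L U Q" and i: "i \<in> {1..n-1}"
    and x0: "x0 \<in> L"
  shows "U i x0 = hadjoint L (U (n - i)) (Q x0)"
proof (rule ccontr)
  assume ne: "U i x0 \<noteq> hadjoint L (U (n - i)) (Q x0)"
  have sub: "csubspace L" using L by (simp add: closed_csubspace_def)
  let ?U = "U(n := Q)" and ?I = "{1..n}"
  have nps: "normal_pair L (?U j) (hadjoint L (?U j))" if "j \<in> ?I" for j
    using U that unfolding Gamma_unitary_def by (intro normal_op_pair[OF L]) blast
  have comm: "?U i (?U j x) = ?U j (?U i x)" if "i \<in> ?I" "j \<in> ?I" "x \<in> L" for i j x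
    using U that unfolding Gamma_unitary_def commuting_tuple_def by blast
  have idx: "i \<in> ?I" "n - i \<in> ?I" "n \<in> ?I" "i \<noteq> n" "n - i \<noteq> n" using i by auto
  define M M' N N' Q' where "M = U (n - i)" and "M' = hadjoint L (U (n - i))" and "N = U i"
    and "N' = hadjoint L (U i)" and "Q' = hadjoint L Q"
  have M: "normal_pair L M M'" and N: "normal_pair L N N'" and Q: "normal_pair L Q Q'"
    using nps[OF idx(1)] nps[OF idx(2)] nps[OF idx(3)] idx by (simp_all add: M_def M'_def N_def N'_def Q'_def)
  note Ma = normal_pairD(1)[OF M] and Na = normal_pairD(1)[OF N] and Qa = normal_pairD(1)[OF Q]
  note Mb = adj_pairD[OF Ma] and Nb = adj_pairD[OF Na] and Qb = adj_pairD[OF Qa]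
  have MN: "M (N x) = N (M x)" and QN: "Q (N x) = N (Q x)" and QM: "Q (M x) = M (Q x)" if "x \<in> L" for x
    using comm[OF idx(2,1) that] comm[OF idx(3,1) that] comm[OF idx(3,2) that] idx
    by (simp_all add: M_def N_def)
  have Q'Q: "Q' (Q x) = x" if "x \<in> L" for x
    using Gamma_unitary_last_unitary[OF L U _ that] idx by (auto simp: Q'_def)
  have QQ': "Q (Q' x) = x" if "x \<in> L" for x
    using Q'Q[OF that] normal_pairD(2)[OF Q that] by simp
  \<comment> \<open>\<open>Q'\<close> is the inverse of \<open>Q\<close>, so commutation with
    \<open>Q\<close> passes to \<open>Q'\<close> by inserting \<open>Q (Q' x)\<close>. This replaces
    Fuglede's theorem for \<open>Q\<close>.\<close>
  have Q'_comm: "Q' (A x) = A (Q' x)" if "adj_pair L A A'" "\<And>x. x \<in> L \<Longrightarrow> Q (A x) = A (Q x)" "x \<in> L" for A A' x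
  proof -
    have "Q' (A x) = Q' (A (Q (Q' x)))" using QQ' that(3) by simp
    also have "\<dots> = Q' (Q (A (Q' x)))" using that Qb(4) by simp
    also have "\<dots> = A (Q' x)" using Q'Q adj_pairD(3)[OF that(1)] Qb(4) that(3) by simp
    finally show ?thesis .
  qed
  have Q'M: "Q' (M x) = M (Q' x)" and Q'N: "Q' (N x) = N (Q' x)" if "x \<in> L" for x
    using Q'_comm[OF Ma QM that] Q'_comm[OF Na QN that] by simp_all
  have QM': "Q (M' x) = M' (Q x)" and QN': "Q (N' x) = N' (Q x)" and M'N': "M' (N' x) = N' (M' x)" if "x \<in> L" for x
    using adj_pair_commute[OF sub adj_pair_sym[OF Qa] Ma Q'M that]
      adj_pair_commute[OF sub adj_pair_sym[OF Qa] Na Q'N that]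
      adj_pair_commute[OF sub Ma Na MN that] by simp_all
  define T where "T x = N x - M' (Q x)" for x
  define T' where "T' x = N' x - Q' (M x)" for x
  have Ta: "adj_pair L T T'"
    using adj_pair_diff[OF sub Na adj_pair_compose[OF adj_pair_sym[OF Ma] Qa]]
    by (simp add: T_def[abs_def] T'_def[abs_def])
  note mem = Mb(3,4) Nb(3,4) Qb(3,4)
  note dist = bounded_op_more(2)[OF Mb(1) sub] bounded_op_more(2)[OF Mb(2) sub]
    bounded_op_more(2)[OF Nb(1) sub] bounded_op_more(2)[OF Nb(2) sub]
    bounded_op_more(2)[OF Qb(1) sub] bounded_op_more(2)[OF Qb(2) sub]
  \<comment> \<open>Both products expand into four terms that agree one by one. \<open>M'\<close>
    meets \<open>N'\<close> and \<open>M\<close> there but never has to be moved past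
    \<open>N\<close>.\<close>
  have "T' (T x) = T (T' x)" if x: "x \<in> L" for x
  proof -
    have 1: "N' (M' (Q x)) = M' (Q (N' x))" using M'N' QN' x mem by simp
    have 2: "Q' (M (N x)) = N (Q' (M x))" using MN Q'N x mem by simp
    have 3: "Q' (M (M' (Q x))) = M' (Q (Q' (M x)))"
      using Q'M QM' x mem normal_pairD(2)[OF M] Q'Q QQ' by (metis (no_types, lifting))
    have 4: "N' (N x) = N (N' x)" by (rule normal_pairD(2)[OF N x])
    show ?thesis unfolding T_def T'_def using x mem 1 2 3 4 by (simp add: dist)
  qed
  then have T: "normal_pair L T T'" using Ta by (simp add: normal_pair_def)
  note Tb = adj_pairD[OF Ta]
  obtain \<tau> where \<tau>: "\<tau> \<noteq> 0" "approx_null L (resid T \<tau>)"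
    using nonzero_approx_eigenvalue[OF sub T x0] ne unfolding T_def N_def M'_def by auto
  have TM: "T (M x) = M (T x)" if x: "x \<in> L" for x
    using x mem MN QM normal_pairD(2)[OF M] by (simp add: T_def dist)
  have TQ: "T (Q x) = Q (T x)" if x: "x \<in> L" for x
    using x mem QN QM' by (simp add: T_def dist)
  obtain q where q: "approx_null L (\<lambda>x. resid T \<tau> x + resid Q q x)"
    using normal_approx_eigenvalue[OF sub Q seminorm_resid[OF Tb(1) sub] stable_resid[OF Tb(1) Qb(1) sub TQ]
        stable_resid_adjoint[OF sub T Qa TQ] \<tau>(2)] by blast
  \<comment> \<open>\<open>T\<close> is refined by \<open>Q\<close> and \<open>M\<close> only, with
    which it commutes; commuting with \<open>N\<close> would mean moving \<open>N\<close> past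
    \<open>M'\<close>.\<close>
  obtain \<mu> where \<mu>: "approx_null L (\<lambda>x. (resid T \<tau> x + resid Q q x) + resid M \<mu> x)"
  proof (rule normal_approx_eigenvalue[OF sub M _ _ _ q])
    show "seminorm_on L (\<lambda>x. resid T \<tau> x + resid Q q x)"
      by (intro seminorm_add seminorm_resid Tb(1) Qb(1) sub)
    show "stable_under L (\<lambda>x. resid T \<tau> x + resid Q q x) M"
      using TM QM by (intro stable_add stable_resid seminorm_resid Tb(1) Qb(1) Mb(1) sub)
    show "stable_under L (\<lambda>x. resid T \<tau> x + resid Q q x) M'"
      by (intro stable_add seminorm_resid Tb(1) Qb(1) sub
          stable_resid_adjoint[OF sub T Ma TM] stable_resid_adjoint[OF sub Q Ma QM])
  qed
  \<comment> \<open>As \<open>N = T + M'Q\<close>, the residual of \<open>N\<close> at this value is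
    controlled by those of \<open>T\<close>, \<open>Q\<close> and \<open>M\<close>. So
    \<open>\<tau>\<close> is stored in \<open>\<nu>\<close>, and \<open>g\<close> can omit
    \<open>T\<close>, which makes it stable under the whole tuple.\<close>
  define \<nu> where "\<nu> = \<tau> + cnj \<mu> * q"
  define g where "g x = resid Q q x + resid M \<mu> x + resid N \<nu> x" for x
  obtain B where B: "B > 0" "\<And>x. x \<in> L \<Longrightarrow> norm (M' x) \<le> B * norm x" using bounded_op_bound[OF Mb(2)] by blast
  have gn: "approx_null L g"
  proof (rule approx_null_mono[OF \<mu>])
    fix x assume x: "x \<in> L"
    have "N x - \<nu> *\<^sub>C x = (T x - \<tau> *\<^sub>C x) + (M' (Q x) - (cnj \<mu> * q) *\<^sub>C x)"
      by (simp add: T_def \<nu>_def scaleC_add_left)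
    then have "resid N \<nu> x \<le> resid T \<tau> x + norm (M' (Q x) - (cnj \<mu> * q) *\<^sub>C x)"
      unfolding resid_def by (metis norm_triangle_ineq)
    also have "norm (M' (Q x) - (cnj \<mu> * q) *\<^sub>C x) \<le> B * resid Q q x + cmod q * resid M' (cnj \<mu>) x"
      by (rule resid_compose[where A=M' and T=Q, OF Mb(2) sub B(2) x Qb(3)[OF x]])
    finally have "g x \<le> resid T \<tau> x + (1 + B) * resid Q q x + (1 + cmod q) * resid M \<mu> x"
      using resid_adjoint[OF sub M x, of \<mu>] by (simp add: g_def distrib_right)
    also have "\<dots> \<le> (1 + B + cmod q) * resid T \<tau> x + (1 + B + cmod q) * resid Q q x + (1 + B + cmod q) * resid M \<mu> x"
    proof -
      have "1 * resid T \<tau> x \<le> (1 + B + cmod q) * resid T \<tau> x"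
        using B by (intro mult_right_mono) (auto simp: resid_def)
      moreover have "(1 + B) * resid Q q x \<le> (1 + B + cmod q) * resid Q q x"
        by (intro mult_right_mono) (auto simp: resid_def)
      moreover have "(1 + cmod q) * resid M \<mu> x \<le> (1 + B + cmod q) * resid M \<mu> x"
        using B by (intro mult_right_mono) (auto simp: resid_def)
      ultimately show ?thesis by linarith
    qed
    finally show "g x \<le> (1 + B + cmod q) * (resid T \<tau> x + resid Q q x + resid M \<mu> x)"
      by (simp add: distrib_left)
  qed (use B in \<open>simp add: add_pos_nonneg\<close>)
  have gs: "seminorm_on L g" unfolding g_def[abs_def] by (intro seminorm_add seminorm_resid Qb(1) Mb(1) Nb(1) sub)
  have st: "stable_under L g (?U j)" "stable_under L g (hadjoint L (?U j))" if j: "j \<in> ?I" for j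
  proof -
    note ja = normal_pairD(1)[OF nps[OF j]]
    note jb = adj_pairD[OF ja]
    have c: "Q (?U j x) = ?U j (Q x)" "M (?U j x) = ?U j (M x)" "N (?U j x) = ?U j (N x)" if "x \<in> L" for x
      using comm[OF idx(3) j that] comm[OF idx(2) j that] comm[OF idx(1) j that] idx(4,5)
      by (simp_all add: M_def N_def)
    show "stable_under L g (?U j)" unfolding g_def[abs_def]
      by (intro stable_add stable_resid seminorm_add seminorm_resid Qb(1) Mb(1) Nb(1) jb(1) sub c)
    show "stable_under L g (hadjoint L (?U j))" unfolding g_def[abs_def]
      by (intro stable_add seminorm_add seminorm_resid Qb(1) Mb(1) Nb(1) sub
          stable_resid_adjoint[OF sub Q ja] stable_resid_adjoint[OF sub M ja] stable_resid_adjoint[OF sub N ja] c)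
  qed
  obtain l where l: "l \<in> bGamma_set n" "approx_null L (\<lambda>x. g x + (\<Sum>j\<in>?I. resid (?U j) (l j) x))"
    using Gamma_unitary_joint_eigenvalue[OF L U gs gn st] by blast
  have eq: "c = l j" if j: "j \<in> ?I" and c: "\<And>x. resid (?U j) c x \<le> g x" for c j
  proof (rule approx_eigenvalue_unique[OF l(2), of "?U j" _ _ 1])
    fix x
    have "resid (?U j) (l j) x \<le> (\<Sum>j\<in>?I. resid (?U j) (l j) x)"
      using j by (intro member_le_sum) (auto simp: resid_def)
    then show "resid (?U j) c x + resid (?U j) (l j) x \<le> 1 * (g x + (\<Sum>j\<in>?I. resid (?U j) (l j) x))"
      using c[of x] by simp
  qed simp
  have "q = l n" "\<mu> = l (n - i)" "\<nu> = l i"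
    using eq[OF idx(3), of q] eq[OF idx(2), of \<mu>] eq[OF idx(1), of \<nu>] idx(4,5)
    by (simp_all add: g_def M_def N_def resid_def)
  then have "\<tau> = 0" using bGamma_set_relation[OF l(1) i] by (simp add: \<nu>_def)
  then show False using \<tau>(1) by simp
qed

section \<open>The compression of the minimal dilation\<close>

text \<open>Polarization: the form is real at \<open>x + y\<close> and at
  \<open>x + \<i> *\<^sub>C y\<close>.\<close>

lemma positive_op_symmetric:
  assumes M: "csubspace M" and D: "positive_op M D" and x: "x \<in> M" and y: "y \<in> M"
  shows "cinner (D x) y = cinner x (D y)"
proof -
  have b: "bounded_op M M D" using D by (simp add: positive_op_def)
  have im: "Im (cinner (D z) z) = 0" if "z \<in> M" for z
    using D that by (auto simp: positive_op_def complex_nonneg_Reals_iff)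
  have "Im (cinner (D (x + y)) (x + y)) = 0" "Im (cinner (D (x + \<i> *\<^sub>C y)) (x + \<i> *\<^sub>C y)) = 0"
    by (intro im csubspaceD[OF M] x y)+
  then have "Im (cinner (D x) y) = - Im (cinner (D y) x)" "Re (cinner (D x) y) = Re (cinner (D y) x)"
    using im[OF x] im[OF y] bounded_opD[OF b] csubspaceD(4)[OF M y] x y
    by (simp_all add: cinner_simps)
  then have "cinner (D x) y = cnj (cinner (D y) x)" by (simp add: complex_eq_iff)
  then show ?thesis using cinner_commute by metis
qed

lemma isometry_op_cinner:
  assumes M: "csubspace M" and J: "isometry_op M N J" and x: "x \<in> M" and y: "y \<in> M"
  shows "cinner (J x) (J y) = cinner x y"
proof -
  have b: "bounded_op M N J" and n: "\<And>z. z \<in> M \<Longrightarrow> norm (J z) = norm z"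
    using J by (auto simp: isometry_op_def)
  have "inner (J x) (J z) = inner x z" if z: "z \<in> M" for z
    using n[OF csubspaceD(2)[OF M x z]] n[OF x] n[OF z] bounded_opD(2)[OF b x z] by (simp add: dot_norm)
  then show ?thesis
    unfolding cinner_eq_Complex using bounded_opD(3)[OF b y] y csubspaceD(4)[OF M y, of \<i>] by metis
qed

lemma commuting_tupleD:
  assumes "commuting_tuple n M T" "i \<in> {1..n}"
  shows "bounded_op M M (T i)" "x \<in> M \<Longrightarrow> T i x \<in> M"
    "j \<in> {1..n} \<Longrightarrow> x \<in> M \<Longrightarrow> T i (T j x) = T j (T i x)"
  using assms bounded_opD(1) unfolding commuting_tuple_def by blast+

text \<open>The extra factor \<open>T i\<close> arises in the middle of the ordered product;
  commutation brings it to the front.\<close>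

lemma op_monom:
  assumes T: "commuting_tuple n M T" and x: "x \<in> M"
  shows "op_monom n T m x \<in> M"
    and "i \<in> {1..n} \<Longrightarrow> op_monom n T (m(i := Suc (m i))) x = T i (op_monom n T m x)"
proof -
  note T' = commuting_tupleD[OF T]
  have pow: "(T j ^^ k) y \<in> M" if "j \<in> {1..n}" "y \<in> M" for j k y
    using that T'(2) by (induction k) auto
  have comm: "(T j ^^ k) (T i y) = T i ((T j ^^ k) y)" if "i \<in> {1..n}" "j \<in> {1..n}" "y \<in> M" for i j k y
    using T'(3)[OF that(2,1)] pow[OF that(2,3)] by (induction k) simp_all
  define F where "F m l = foldr (\<lambda>i F. (T i ^^ m i) \<circ> F) l id" for m l
  have F: "F m [] y = y" "F m (j # l) y = (T j ^^ m j) (F m l y)" for m j l y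
    by (simp_all add: F_def)
  have op: "op_monom n T m = F m [1..<Suc n]" for m by (simp only: op_monom_def F_def)
  have set: "set [1..<Suc n] \<subseteq> {1..n}" "distinct [1..<Suc n]" by auto
  have mem: "F m l x \<in> M" if "set l \<subseteq> {1..n}" for l m
    using that by (induction l) (use x pow in \<open>auto simp: F\<close>)
  then show "op_monom n T m x \<in> M" using set unfolding op by blast
  \<comment> \<open>Stated for arbitrary lists to permit induction; distinctness ensures that the
    raised exponent is met only once.\<close>
  have eq: "F (m(i := Suc (m i))) l x = (if i \<in> set l then T i (F m l x) else F m l x)"
    if "i \<in> {1..n}" "set l \<subseteq> {1..n}" "distinct l" for l i
    using that(2,3)
  proof (induction l)
    case (Cons j l)
    then show ?case using mem[of l m] comm[OF that(1), of j "F m l x" "m j"] by (auto simp: F)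
  qed (simp add: F)
  show "op_monom n T (m(i := Suc (m i))) x = T i (op_monom n T m x)" if i: "i \<in> {1..n}"
    unfolding op eq[OF i set] using i by auto
qed

lemma closure_image_sequence:
  fixes D :: "'a \<Rightarrow> 'b::metric_space"
  assumes "z \<in> closure (D ` H)"
  shows "\<exists>h. (\<forall>k. h k \<in> H) \<and> (\<lambda>k. D (h k)) \<longlonglongrightarrow> z"
proof -
  from assms obtain s where s: "\<forall>k. s k \<in> D ` H" "s \<longlonglongrightarrow> z"
    unfolding closure_sequential by (elim exE conjE)
  then have "\<forall>k. \<exists>h. h \<in> H \<and> D h = s k" by (metis imageE)
  then obtain h where "\<And>k. h k \<in> H" "\<And>k. D (h k) = s k" by metis
  then show ?thesis using s(2) by (intro exI[of _ h]) simp
qed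

lemma csubspace_image:
  assumes H: "csubspace H" and D: "bounded_op H M D"
  shows "csubspace (D ` H)"
  unfolding complex_space.subspace_def
proof (intro conjI ballI allI)
  show "0 \<in> D ` H" using bounded_op_more(1)[OF D H] csubspaceD(1)[OF H] by force
  fix u assume "u \<in> D ` H"
  then obtain h where h: "h \<in> H" "u = D h" by blast
  show "c *\<^sub>C u \<in> D ` H" for c
    using bounded_opD(3)[OF D h(1), of c] csubspaceD(4)[OF H h(1), of c] h(2) by force
  fix v assume "v \<in> D ` H"
  then obtain k where k: "k \<in> H" "v = D k" by blast
  show "u + v \<in> D ` H"
    using bounded_opD(2)[OF D h(1) k(1)] csubspaceD(2)[OF H h(1) k(1)] h(2) k(2) by force
qed

text \<open>Equality of norms makes \<open>D h \<mapsto> E h\<close> well defined and isometric, and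
  completeness extends it to the closure. Here \<open>\<phi>\<close> will arise from the defect
  operator and \<open>V - P\<close>.\<close>

lemma isometric_factor_exists:
  fixes D E :: "'a::complex_hilbert_space \<Rightarrow> 'b::complex_hilbert_space"
  assumes H: "csubspace H" and D: "bounded_op H M D" and E: "bounded_op H N E" and N: "closed N"
    and iso: "\<And>h. h \<in> H \<Longrightarrow> norm (E h) = norm (D h)"
  obtains \<phi> where "isometry_op (closure (D ` H)) N \<phi>" "\<And>h. h \<in> H \<Longrightarrow> \<phi> (D h) = E h"
proof -
  let ?C = "closure (D ` H)"
  have dist: "norm (E h - E k) = norm (D h - D k)" if "h \<in> H" "k \<in> H" for h k
    using iso[OF csubspaceD(3)[OF H that]] bounded_op_more(2)[OF D H that] bounded_op_more(2)[OF E H that] by simp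
  note seq = closure_image_sequence[of _ D H]
  \<comment> \<open>The limit is asserted for all approximating sequences at once, so that
    additivity and homogeneity can be checked on whichever sequence is convenient.\<close>
  have "\<exists>y\<in>N. \<forall>h. (\<forall>k. h k \<in> H) \<longrightarrow> (\<lambda>k. D (h k)) \<longlonglongrightarrow> x \<longrightarrow> (\<lambda>k. E (h k)) \<longlonglongrightarrow> y" if x: "x \<in> ?C" for x
  proof -
    obtain h where h: "\<And>k. h k \<in> H" "(\<lambda>k. D (h k)) \<longlonglongrightarrow> x" using seq[OF x] by blast
    have "Cauchy (\<lambda>k. D (h k))" using h(2) LIMSEQ_imp_Cauchy by blast
    then have "Cauchy (\<lambda>k. E (h k))" unfolding Cauchy_def dist_norm using dist h(1) by simp
    then obtain y where y: "(\<lambda>k. E (h k)) \<longlonglongrightarrow> y" using Cauchy_convergent convergent_def by blast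
    have "(\<lambda>k. E (g k)) \<longlonglongrightarrow> y" if g: "\<forall>k. g k \<in> H" "(\<lambda>k. D (g k)) \<longlonglongrightarrow> x" for g
    proof -
      have "(\<lambda>k. norm (D (g k) - D (h k))) \<longlonglongrightarrow> norm (x - x)" by (intro tendsto_intros g h)
      then have "(\<lambda>k. E (g k) - E (h k)) \<longlonglongrightarrow> 0"
        using dist g h(1) by (subst tendsto_norm_zero_iff[symmetric]) simp
      from tendsto_add[OF this y] show ?thesis by simp
    qed
    moreover have "y \<in> N" using closed_sequentially[OF N _ y] bounded_opD(1)[OF E] h(1) by blast
    ultimately show ?thesis by blast
  qed
  then obtain \<phi> where \<phi>N: "\<And>x. x \<in> ?C \<Longrightarrow> \<phi> x \<in> N"
    and \<phi>: "\<And>x h. x \<in> ?C \<Longrightarrow> (\<And>k. h k \<in> H) \<Longrightarrow> (\<lambda>k. D (h k)) \<longlonglongrightarrow> x \<Longrightarrow> (\<lambda>k. E (h k)) \<longlonglongrightarrow> \<phi> x"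
    by metis
  have \<phi>eq: "\<phi> x = y" if "x \<in> ?C" "\<And>k. h k \<in> H" "(\<lambda>k. D (h k)) \<longlonglongrightarrow> x" "(\<lambda>k. E (h k)) \<longlonglongrightarrow> y" for x y h
    using LIMSEQ_unique[OF \<phi>[OF that(1-3)] that(4)] .
  have C: "csubspace ?C" by (intro closure_csubspace csubspace_image[OF H D])
  show ?thesis
  proof (rule that)
    show "\<phi> (D h) = E h" if "h \<in> H" for h
      using that closure_subset[of "D ` H"] by (intro \<phi>eq[of _ "\<lambda>_. h"]) auto
    have norm: "norm (\<phi> x) = norm x" if x: "x \<in> ?C" for x
    proof -
      obtain h where h: "\<And>k. h k \<in> H" "(\<lambda>k. D (h k)) \<longlonglongrightarrow> x" using seq[OF x] by blast
      have "(\<lambda>k. norm (E (h k))) \<longlonglongrightarrow> norm (\<phi> x)" by (intro tendsto_norm \<phi> x h)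
      moreover have "(\<lambda>k. norm (E (h k))) \<longlonglongrightarrow> norm x"
        using tendsto_norm[OF h(2)] iso h(1) by simp
      ultimately show ?thesis by (rule LIMSEQ_unique)
    qed
    have add: "\<phi> (x + y) = \<phi> x + \<phi> y" if x: "x \<in> ?C" and y: "y \<in> ?C" for x y
    proof -
      obtain h where h: "\<And>k. h k \<in> H" "(\<lambda>k. D (h k)) \<longlonglongrightarrow> x" using seq[OF x] by blast
      obtain g where g: "\<And>k. g k \<in> H" "(\<lambda>k. D (g k)) \<longlonglongrightarrow> y" using seq[OF y] by blast
      show ?thesis
      proof (rule \<phi>eq)
        show "h k + g k \<in> H" for k using h g csubspaceD(2)[OF H] by simp
        show "(\<lambda>k. D (h k + g k)) \<longlonglongrightarrow> x + y"
          using tendsto_add[OF h(2) g(2)] bounded_opD(2)[OF D h(1) g(1)] by simp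
        show "(\<lambda>k. E (h k + g k)) \<longlonglongrightarrow> \<phi> x + \<phi> y"
          using tendsto_add[OF \<phi>[OF x h] \<phi>[OF y g]] bounded_opD(2)[OF E h(1) g(1)] by simp
      qed (rule csubspaceD(2)[OF C x y])
    qed
    have scale: "\<phi> (c *\<^sub>C x) = c *\<^sub>C \<phi> x" if x: "x \<in> ?C" for c x
    proof -
      obtain h where h: "\<And>k. h k \<in> H" "(\<lambda>k. D (h k)) \<longlonglongrightarrow> x" using seq[OF x] by blast
      show ?thesis
      proof (rule \<phi>eq)
        show "c *\<^sub>C h k \<in> H" for k using h csubspaceD(4)[OF H] by simp
        show "(\<lambda>k. D (c *\<^sub>C h k)) \<longlonglongrightarrow> c *\<^sub>C x"
          using tendsto_scaleC[OF h(2)] bounded_opD(3)[OF D h(1)] by simp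
        show "(\<lambda>k. E (c *\<^sub>C h k)) \<longlonglongrightarrow> c *\<^sub>C \<phi> x"
          using tendsto_scaleC[OF \<phi>[OF x h]] bounded_opD(3)[OF E h(1)] by simp
      qed (rule csubspaceD(4)[OF C x])
    qed
    show "isometry_op ?C N \<phi>"
      unfolding isometry_op_def bounded_op_def
      using \<phi>N norm add scale by (auto intro!: exI[of _ 1])
  qed
qed

section \<open>Restrictions, algebraic relations and co-extension of the dilation\<close>

lemma bounded_op_restrict:
  assumes "bounded_op K N T" "M \<subseteq> K" "\<And>x. x \<in> M \<Longrightarrow> T x \<in> N'"
  shows "bounded_op M N' T"
  using assms unfolding bounded_op_def by blast

lemma closed_csubspace_orth_diff:
  assumes K: "closed_csubspace K"
  shows "closed_csubspace (K \<ominus>\<^sub>H H)"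
proof -
  have s: "csubspace K" and c: "closed K" using K by (auto simp: closed_csubspace_def)
  have "csubspace (K \<ominus>\<^sub>H H)"
    unfolding complex_space.subspace_def orth_diff_def using csubspaceD[OF s] by (auto simp: cinner_simps)
  moreover have "closed (K \<ominus>\<^sub>H H)"
    unfolding closed_sequential_limits
  proof (intro allI impI, elim conjE)
    fix u l assume u: "\<forall>n. u n \<in> K \<ominus>\<^sub>H H" "u \<longlonglongrightarrow> l"
    have "l \<in> K" using u(1) closed_sequentially[OF c _ u(2)] by (simp add: orth_diff_def)
    moreover have "cinner l y = 0" if y: "y \<in> H" for y
    proof -
      have "(\<lambda>n. cinner (u n) y) \<longlonglongrightarrow> cinner l y" by (intro tendsto_intros u)
      then show ?thesis using u(1) y by (simp add: orth_diff_def LIMSEQ_const_iff)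
    qed
    ultimately show "l \<in> K \<ominus>\<^sub>H H" by (simp add: orth_diff_def)
  qed
  ultimately show ?thesis by (simp add: closed_csubspace_def)
qed

lemma Gamma_isometry_restrict:
  assumes R: "Gamma_isometry TYPE('b::complex_hilbert_space) n K R V" and "M \<subseteq> K"
    and inv: "\<And>i x. i \<in> {1..n} \<Longrightarrow> x \<in> M \<Longrightarrow> (R(n := V)) i x \<in> M"
  shows "Gamma_isometry TYPE('b) n M R V"
proof -
  from R obtain L :: "'b set" and U Q J where
    com: "commuting_tuple n K (R(n := V))" and
    L: "closed_csubspace L" "Gamma_unitary n L U Q" "isometry_op K L J"
      "\<forall>i\<in>{1..n}. \<forall>x\<in>K. J ((R(n := V)) i x) = (U(n := Q)) i (J x)"
    unfolding Gamma_isometry_def by blast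
  have "bounded_op M M ((R(n := V)) i)" if "i \<in> {1..n}" for i
    using bounded_op_restrict[OF commuting_tupleD(1)[OF com that] \<open>M \<subseteq> K\<close> inv[OF that]] .
  then have "commuting_tuple n M (R(n := V))"
    using com \<open>M \<subseteq> K\<close> unfolding commuting_tuple_def by blast
  moreover have "isometry_op M L J"
    using L(3) \<open>M \<subseteq> K\<close> bounded_op_restrict[of K L J M L] bounded_opD(1)[of K L J]
    unfolding isometry_op_def by blast
  ultimately show ?thesis using L \<open>M \<subseteq> K\<close> unfolding Gamma_isometry_def by blast
qed

text \<open>The identities of the unitary extension in weak form. An isometry \<open>J\<close>
  transports inner products but not adjoints, so this is the form in which they descend from
  \<open>L\<close> to \<open>K\<close>.\<close>

lemma Gamma_isometry_relations:
  assumes R: "Gamma_isometry TYPE('b::complex_hilbert_space) n K R V" and K: "csubspace K"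
  shows "n \<ge> 1 \<Longrightarrow> x \<in> K \<Longrightarrow> y \<in> K \<Longrightarrow> cinner (V x) (V y) = cinner x y"
    and "i \<in> {1..n-1} \<Longrightarrow> x \<in> K \<Longrightarrow> y \<in> K \<Longrightarrow> cinner (R i x) y = cinner (V x) (R (n - i) y)"
proof -
  from R obtain L :: "'b set" and U Q J where
    com: "commuting_tuple n K (R(n := V))" and
    L: "closed_csubspace L" and U: "Gamma_unitary n L U Q" and J: "isometry_op K L J" and
    JR: "\<And>i x. i \<in> {1..n} \<Longrightarrow> x \<in> K \<Longrightarrow> J ((R(n := V)) i x) = (U(n := Q)) i (J x)"
    unfolding Gamma_isometry_def by blast
  note Jc = isometry_op_cinner[OF K J]
  have JL: "J x \<in> L" if "x \<in> K" for x using J that by (auto simp: isometry_op_def bounded_op_def)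
  have RK: "(R(n := V)) i x \<in> K" if "i \<in> {1..n}" "x \<in> K" for i x
    using commuting_tupleD(2)[OF com that] .
  have Ub: "bounded_op L L ((U(n := Q)) i)" if "i \<in> {1..n}" for i
    using U commuting_tupleD(1)[OF _ that] unfolding Gamma_unitary_def by blast
  show "cinner (V x) (V y) = cinner x y" if n: "n \<ge> 1" and x: "x \<in> K" and y: "y \<in> K"
  proof -
    have Q: "bounded_op L L Q" using Ub[of n] n by simp
    have V: "V x \<in> K" "V y \<in> K" "J (V x) = Q (J x)" "J (V y) = Q (J y)"
      using RK[of n] JR[of n] n x y by auto
    have "cinner (V x) (V y) = cinner (Q (J x)) (Q (J y))" using Jc V by metis
    also have "\<dots> = cinner (J x) (hadjoint L Q (Q (J y)))" using hadjoint(2)[OF L Q JL[OF x]] .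
    also have "\<dots> = cinner (J x) (J y)" using Gamma_unitary_last_unitary[OF L U n JL[OF y]] by simp
    finally show ?thesis using Jc x y by simp
  qed
  show "cinner (R i x) y = cinner (V x) (R (n - i) y)" if i: "i \<in> {1..n-1}" and x: "x \<in> K" and y: "y \<in> K"
  proof -
    have idx: "i \<in> {1..n}" "n - i \<in> {1..n}" "n \<in> {1..n}" "i \<noteq> n" "n - i \<noteq> n" using i by auto
    have M: "bounded_op L L (U (n - i))" and Q: "bounded_op L L Q"
      using Ub[OF idx(2)] Ub[OF idx(3)] idx(5) by simp_all
    have m: "R i x \<in> K" "R (n - i) y \<in> K" "V x \<in> K"
      and j: "J (R i x) = U i (J x)" "J (R (n - i) y) = U (n - i) (J y)" "J (V x) = Q (J x)"
      using RK[OF idx(1) x] RK[OF idx(2) y] RK[OF idx(3) x] JR[OF idx(1) x] JR[OF idx(2) y] JR[OF idx(3) x] idx(4,5)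
      by simp_all
    have "cinner (R i x) y = cinner (U i (J x)) (J y)" using Jc[OF m(1) y] j by simp
    also have "\<dots> = cinner (hadjoint L (U (n - i)) (Q (J x))) (J y)"
      using Gamma_unitary_relation[OF L U i JL[OF x]] by simp
    also have "\<dots> = cinner (Q (J x)) (U (n - i) (J y))"
      using hadjoint(2)[OF L M JL[OF y], of "Q (J x)"] by (metis cinner_commute)
    also have "\<dots> = cinner (V x) (R (n - i) y)" using Jc[OF m(3,2)] j by simp
    finally show ?thesis .
  qed
qed

text \<open>
  By minimality it suffices to compare on the vectors \<open>R\<^sup>m h\<close>; in other words \<open>S\<^sub>i\<^sup>*\<close> is the
  restriction of \<open>R\<^sub>i\<^sup>*\<close> to \<open>H\<close>.
\<close>

lemma minimal_dilation_coextension: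
  assumes H: "closed_csubspace H" and K: "closed_csubspace K"
    and S: "commuting_tuple n H (S(n := P))"
    and dil: "Gamma_isometric_dilation TYPE('b::complex_hilbert_space) n H S P K R V"
    and min: "minimal_dilation n H K R V"
    and i: "i \<in> {1..n}" and x: "x \<in> K" and k: "k \<in> H"
  shows "cinner ((R(n := V)) i x) k = cinner x (hadjoint H ((S(n := P)) i) k)"
proof -
  have Ks: "csubspace K" using K by (simp add: closed_csubspace_def)
  let ?R = "R(n := V)" and ?S = "S(n := P)"
  let ?G = "{op_monom n ?R m h | m h. h \<in> H}"
  have HK: "H \<subseteq> K" and R: "commuting_tuple n K ?R"
    and pr: "\<And>m h. h \<in> H \<Longrightarrow> orth_proj H (op_monom n ?R m h) = op_monom n ?S m h"
    using dil by (auto simp: Gamma_isometric_dilation_def Gamma_isometry_def)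
  have Kcl: "K = closure (cspan ?G)" using min by (simp add: minimal_dilation_def)
  have Rb: "bounded_op K K (?R i)" and Sb: "bounded_op H H (?S i)"
    using R S i by (auto simp: commuting_tuple_def)
  have compr: "cinner (op_monom n ?R m h) y = cinner (op_monom n ?S m h) y" if "h \<in> H" "y \<in> H" for m h y
    using orth_proj(2)[OF H that(2), of "op_monom n ?R m h"] pr[OF that(1)] by (simp add: cinner_simps)
  let ?k = "hadjoint H (?S i) k"
  have span: "x \<in> K \<and> cinner (?R i x) k = cinner x ?k" if "x \<in> cspan ?G" for x
    using that
  proof (induction rule: complex_space.span_induct_alt)
    case base
    then show ?case using bounded_op_more(1)[OF Rb Ks] csubspaceD(1)[OF Ks] by simp
  next
    case (step c g y)
    then obtain m h where g: "g = op_monom n ?R m h" "h \<in> H" by blast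
    have gK: "g \<in> K" unfolding g(1) using g(2) HK by (intro op_monom(1)[OF R]) blast
    \<comment> \<open>Applying \<open>?R i\<close> to a generator gives another generator, whose
      compression is again a monomial in \<open>?S\<close>; there the factor \<open>?S i\<close> can
      be moved to \<open>k\<close>.\<close>
    have "cinner (?R i g) k = cinner (op_monom n ?R (m(i := Suc (m i))) h) k"
      using op_monom(2)[OF R _ i] g HK by auto
    also have "\<dots> = cinner (?S i (op_monom n ?S m h)) k"
      using compr[OF g(2) k] op_monom(2)[OF S g(2) i] by simp
    also have "\<dots> = cinner (op_monom n ?S m h) ?k"
      by (intro hadjoint(2)[OF H Sb] op_monom(1)[OF S] g(2))
    also have "\<dots> = cinner g ?k" using compr[OF g(2) hadjoint(1)[OF H Sb]] g(1) by simp
    finally have "cinner (?R i g) k = cinner g ?k" .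
    then show ?case
      using step gK csubspaceD[OF Ks] bounded_opD(2,3)[OF Rb] by (simp add: cinner_simps)
  qed
  obtain s where s: "\<And>k. s k \<in> cspan ?G" "s \<longlonglongrightarrow> x" using x unfolding Kcl closure_sequential by blast
  have "(\<lambda>j. ?R i (s j)) \<longlonglongrightarrow> ?R i x" using span s x by (intro bounded_op_tendsto[OF Rb Ks]) auto
  then have "(\<lambda>j. cinner (?R i (s j)) k) \<longlonglongrightarrow> cinner (?R i x) k" by (intro tendsto_intros)
  then have "(\<lambda>j. cinner (s j) ?k) \<longlonglongrightarrow> cinner (?R i x) k"
    using span s(1) by (simp del: fun_upd_apply)
  moreover have "(\<lambda>j. cinner (s j) ?k) \<longlonglongrightarrow> cinner x ?k" by (intro tendsto_intros s)
  ultimately show ?thesis by (rule LIMSEQ_unique)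
qed

theorem theorem3p9:
  fixes n :: nat
    and H K :: "'a::complex_hilbert_space set"
    and S R A :: "nat \<Rightarrow> 'a \<Rightarrow> 'a"
    and P V D :: "'a \<Rightarrow> 'a"
  assumes "n \<ge> 2"
    and "closed_csubspace H" and "closed_csubspace K"
    and "Gamma_contraction n H S P"
    and "is_defect_op H P D"
    and "is_FO_tuple n H S P D A"
    and "Gamma_isometric_dilation TYPE('b::complex_hilbert_space) n H S P K R V"
    and "minimal_dilation n H K R V"
  shows "\<exists>W Wn \<phi>. Gamma_isometry TYPE('b) n (K \<ominus>\<^sub>H H) W Wn \<and>
           isometry_op (closure (D ` H)) (K \<ominus>\<^sub>H H) \<phi> \<and>
           (\<forall>i\<in>{1..n-1}. \<forall>x \<in> closure (D ` H).
              A i x = hadjoint (closure (D ` H)) \<phi> (W i (\<phi> x)))"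
proof -
  note H = assms(2) and K = assms(3)
  have Hs: "csubspace H" and Hc: "closed H" and Ks: "csubspace K" using H K by (auto simp: closed_csubspace_def)
  let ?R = "R(n := V)" and ?S = "S(n := P)" and ?N = "K \<ominus>\<^sub>H H" and ?C = "closure (D ` H)"
  have Ns: "csubspace ?N" and Nc: "closed ?N"
    using closed_csubspace_orth_diff[OF K] by (auto simp: closed_csubspace_def)
  have S: "commuting_tuple n H ?S" using assms(4) by (simp add: Gamma_contraction_def)
  have HK: "H \<subseteq> K" and R: "Gamma_isometry TYPE('b) n K R V"
    using assms(7) by (auto simp: Gamma_isometric_dilation_def)
  have Rb: "bounded_op K K (?R i)" and Sb: "bounded_op H H (?S i)" if "i \<in> {1..n}" for i
    using R S that by (auto simp: commuting_tuple_def Gamma_isometry_def)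
  have idx: "i \<in> {1..n}" "i \<noteq> n" "n - i \<in> {1..n-1}" if "i \<in> {1..n-1}" for i using that by auto
  have Vb: "bounded_op K K V" and Pb: "bounded_op H H P" using Rb[of n] Sb[of n] assms(1) by auto
  have Rbi: "bounded_op K K (R i)" and Sbi: "bounded_op H H (S i)" if "i \<in> {1..n-1}" for i
    using Rb[OF idx(1)[OF that]] Sb[OF idx(1)[OF that]] idx(2)[OF that] by simp_all
  have VR: "V (R i x) = R i (V x)" if "i \<in> {1..n-1}" "x \<in> K" for i x
  proof -
    have n: "n \<in> {1..n}" using assms(1) by simp
    have "commuting_tuple n K ?R" using R unfolding Gamma_isometry_def by blast
    from commuting_tupleD(3)[OF this n idx(1)[OF that(1)] that(2)]
    show ?thesis using idx(2)[OF that(1)] by simp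
  qed
  note co = minimal_dilation_coextension[OF H K S assms(7,8)]
  \<comment> \<open>The adjoint of \<open>?R i\<close> maps \<open>H\<close> into \<open>H\<close>,
    hence \<open>?R i\<close> preserves the orthogonal complement.\<close>
  have inv: "?R i x \<in> ?N" if "i \<in> {1..n}" "x \<in> ?N" for i x
    using co[OF that(1)] hadjoint(1)[OF H Sb[OF that(1)]] bounded_opD(1)[OF Rb[OF that(1)]] that(2)
    by (auto simp: orth_diff_def)
  have compr: "cinner (?R i h) k = cinner (?S i h) k" if "i \<in> {1..n}" "h \<in> H" "k \<in> H" for i h k
    using co[OF that(1) _ that(3)] hadjoint(2)[OF H Sb[OF that(1)] that(2)] HK that(2) by auto
  have comprV: "cinner (V h) k = cinner (P h) k" if "h \<in> H" "k \<in> H" for h k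
    using compr[of n h k] assms(1) that by simp
  have comprR: "cinner (R i h) k = cinner (S i h) k" if "i \<in> {1..n-1}" "h \<in> H" "k \<in> H" for i h k
    using compr[OF idx(1)[OF that(1)] that(2,3)] idx(2)[OF that(1)] by simp
  have Viso: "cinner (V x) (V y) = cinner x y" if "x \<in> K" "y \<in> K" for x y
    using Gamma_isometry_relations(1)[OF R Ks _ that] assms(1) by simp

  have Db: "bounded_op H H D" and Dpos: "positive_op H D"
    and DD: "\<And>h. h \<in> H \<Longrightarrow> D (D h) = h - hadjoint H P (P h)"
    using assms(5) by (auto simp: is_defect_op_def positive_op_def)
  note Dsym = positive_op_symmetric[OF Hs Dpos]
  note DH = bounded_opD(1)[OF Db] and PH = bounded_opD(1)[OF Pb] and VK = bounded_opD(1)[OF Vb]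
  have CH: "?C \<subseteq> H" using Hc DH by (intro closure_minimal) auto
  \<comment> \<open>Since \<open>P h\<close> is the projection of \<open>V h\<close> onto
    \<open>H\<close>, this is the component of \<open>V h\<close> in \<open>?N\<close>.\<close>
  define E where "E h = V h - P h" for h
  have EN: "E h \<in> ?N" if "h \<in> H" for h
  proof -
    have "V h \<in> K" "P h \<in> K" using that VK PH HK by blast+
    then show ?thesis using comprV[OF that] csubspaceD(3)[OF Ks] by (auto simp: orth_diff_def E_def cinner_simps)
  qed
  have orth: "cinner x y = 0" "cinner y x = 0" if "x \<in> ?N" "y \<in> H" for x y
    using that cinner_commute[of y x] by (auto simp: orth_diff_def)
  \<comment> \<open>By orthogonality the product is \<open>cinner h k - cinner (P h) (P k)\<close>,
    the form of the squared defect operator.\<close>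
  have EE: "cinner (E h) (E k) = cinner (D h) (D k)" if h: "h \<in> H" and k: "k \<in> H" for h k
  proof -
    have "cinner (E h) (E k) = cinner (E h) (V k)"
      using orth(1)[OF EN[OF h] PH[OF k]] by (simp add: E_def[of k] cinner_simps)
    also have "\<dots> = cinner h k - cinner (P h) (V k)"
      using Viso h k HK by (auto simp: E_def cinner_simps)
    also have "cinner (P h) (V k) = cinner (P h) (P k)"
      using comprV[OF k PH[OF h]] by (metis cinner_commute)
    also have "\<dots> = cinner h (hadjoint H P (P k))" by (rule hadjoint(2)[OF H Pb h])
    also have "cinner h k - \<dots> = cinner h (D (D k))" using DD[OF k] by (simp add: cinner_simps)
    finally show ?thesis using Dsym[OF h DH[OF k]] by simp
  qed
  have "bounded_op H K V" "bounded_op H K P"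
    using bounded_op_restrict[OF Vb HK] bounded_op_restrict[OF Pb subset_refl] VK PH HK by blast+
  then have "bounded_op H K E" unfolding E_def[abs_def] by (intro bounded_op_diff Ks)
  then have Eb: "bounded_op H ?N E" by (rule bounded_op_restrict) (simp_all add: EN)
  have "norm (E h) = norm (D h)" if "h \<in> H" for h
    using EE[OF that that] unfolding cinner_self of_real_eq_iff by (simp add: power2_eq_iff_nonneg)
  then obtain \<phi> where \<phi>: "isometry_op ?C ?N \<phi>" "\<And>h. h \<in> H \<Longrightarrow> \<phi> (D h) = E h"
    using isometric_factor_exists[OF Hs Db Eb Nc] by blast
  have \<phi>b: "bounded_op ?C ?N \<phi>" using \<phi>(1) by (simp add: isometry_op_def)
  have Cs: "csubspace ?C" by (intro closure_csubspace csubspace_image[OF Hs Db])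
  \<comment> \<open>\<open>E k\<close> may be replaced by \<open>V k\<close>, because
    \<open>R i (E h)\<close> is orthogonal to \<open>H\<close>. Expanding \<open>E h\<close>, the
    term with \<open>V h\<close> reduces to \<open>S i h\<close> by cancelling \<open>V\<close>, and
    the term with \<open>P h\<close> becomes the adjoint of \<open>S (n - i)\<close> applied to
    \<open>P h\<close>, by the weak relation followed by another cancellation. The difference is the
    defining expression of \<open>A i\<close>.\<close>
  have main: "cinner (E k) (R i (E h)) = cinner (D k) (A i (D h))"
    if i: "i \<in> {1..n-1}" and h: "h \<in> H" and k: "k \<in> H" for i h k
  proof -
    note i' = idx(3,1,2)[OF i]
    have RE: "R i (E h) \<in> ?N" using inv[OF i'(2) EN[OF h]] i'(3) by simp
    have hK: "h \<in> K" "k \<in> K" "P h \<in> K" using h k HK PH by auto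
    have "cinner (R i (E h)) (E k) = cinner (R i (E h)) (V k)"
      using orth(1)[OF RE PH[OF k]] by (simp add: E_def[of k] cinner_simps)
    also have "\<dots> = cinner (R i (V h)) (V k) - cinner (R i (P h)) (V k)"
      using bounded_op_more(2)[OF Rbi[OF i] Ks VK[OF hK(1)] hK(3)] by (simp add: E_def cinner_simps)
    also have "cinner (R i (V h)) (V k) = cinner (S i h) k"
      using VR[OF i hK(1)] Viso[OF bounded_opD(1)[OF Rbi[OF i] hK(1)] hK(2)] comprR[OF i h k] by simp
    also have "cinner (R i (P h)) (V k) = cinner (V (P h)) (V (R (n - i) k))"
      using Gamma_isometry_relations(2)[OF R Ks i hK(3) VK[OF hK(2)]] VR[OF i'(1) hK(2)] by simp
    also have "\<dots> = cinner (P h) (R (n - i) k)"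
      by (rule Viso[OF hK(3) bounded_opD(1)[OF Rbi[OF i'(1)] hK(2)]])
    also have "\<dots> = cinner (P h) (S (n - i) k)"
      using comprR[OF i'(1) k PH[OF h]] by (metis cinner_commute)
    also have "\<dots> = cinner (hadjoint H (S (n - i)) (P h)) k"
      using hadjoint(2)[OF H Sbi[OF i'(1)] k] by (metis cinner_commute)
    also have "cinner (S i h) k - \<dots> = cinner (D (A i (D h))) k"
      using assms(6) i h by (simp add: is_FO_tuple_def flip: cinner_diff_left)
    also have "\<dots> = cinner (A i (D h)) (D k)"
    proof (rule Dsym[OF _ k])
      have "D h \<in> ?C" using h closure_subset[of "D ` H"] by auto
      then show "A i (D h) \<in> H" using assms(6) i CH bounded_opD(1)[of ?C ?C "A i"] by (auto simp: is_FO_tuple_def)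
    qed
    finally show ?thesis by (metis cinner_commute)
  qed
  \<comment> \<open>The vectors \<open>D h\<close> are dense in \<open>?C\<close>, so
    \<open>main\<close> extends to all of \<open>?C\<close> by continuity.\<close>
  have "A i x = hadjoint ?C \<phi> (R i (\<phi> x))" if i: "i \<in> {1..n-1}" and x: "x \<in> ?C" for i x
  proof (rule hadjoint_eqI[OF Cs, symmetric])
    have Ab: "bounded_op ?C ?C (A i)" using assms(6) i by (simp add: is_FO_tuple_def)
    show "A i x \<in> ?C" by (rule bounded_opD(1)[OF Ab x])
    fix y assume y: "y \<in> ?C"
    note seq = closure_image_sequence[of _ D H]
    obtain h where h: "\<And>k. h k \<in> H" "(\<lambda>k. D (h k)) \<longlonglongrightarrow> x" using seq[OF x] by blast
    obtain g where g: "\<And>k. g k \<in> H" "(\<lambda>k. D (g k)) \<longlonglongrightarrow> y" using seq[OF y] by blast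
    have DC: "D (h k) \<in> ?C" "D (g k) \<in> ?C" for k
      using h(1)[of k] g(1)[of k] closure_subset[of "D ` H"] by auto
    have e: "(\<lambda>k. E (h k)) \<longlonglongrightarrow> \<phi> x" "(\<lambda>k. E (g k)) \<longlonglongrightarrow> \<phi> y"
      using bounded_op_tendsto[OF \<phi>b Cs DC(1) x h(2)] bounded_op_tendsto[OF \<phi>b Cs DC(2) y g(2)] \<phi>(2) h(1) g(1)
      by simp_all
    have NK: "?N \<subseteq> K" by (auto simp: orth_diff_def)
    have "(\<lambda>k. R i (E (h k))) \<longlonglongrightarrow> R i (\<phi> x)"
      using EN h(1) NK bounded_opD(1)[OF \<phi>b x] by (intro bounded_op_tendsto[OF Rbi[OF i] Ks _ _ e(1)]) auto
    then have "(\<lambda>k. cinner (E (g k)) (R i (E (h k)))) \<longlonglongrightarrow> cinner (\<phi> y) (R i (\<phi> x))"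
      by (intro tendsto_intros e)
    moreover have "(\<lambda>k. cinner (D (g k)) (A i (D (h k)))) \<longlonglongrightarrow> cinner y (A i x)"
      by (intro tendsto_intros g bounded_op_tendsto[OF Ab Cs DC(1) x h(2)])
    ultimately show "cinner (\<phi> y) (R i (\<phi> x)) = cinner y (A i x)"
      using main[OF i h(1) g(1)] LIMSEQ_unique by simp
  qed
  moreover have "Gamma_isometry TYPE('b) n ?N R V"
    using inv by (intro Gamma_isometry_restrict[OF R]) (auto simp: orth_diff_def)
  ultimately show ?thesis using \<phi>(1) by blast
qed

end
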